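(* Let $n\geq 1$ and $r$ be integers with $0\leq r\leq n-1$. Let \[ \alpha_{n,r}=\frac{2^{n-1}}{\sum_{i=r+1}^n\binom{n}{i}}, \] and set $k=\lfloor \alpha_{n,r}\rfloor$ if $\alpha_{n,r}$ is not an integer, and $k=\alpha_{n,r}-1$ if $\alpha_{n,r}$ is an integer. Then the Vietoris-Rips complex $VR(Q_n;r)$ is $(k-1)$-connected.
   Context: $Q_n$ denotes the set of $2^n$ binary strings of length $n$ (the vertices of the $n$-dimensional hypercube), equipped with the Hamming distance $d_H$ (the number of coordinates at which two strings differ), which coincides with the shortest path metric of the hypercube graph. For $r\geq 0$, the Vietoris-Rips complex $VR(Q_n;r)$ is the simplicial complex with vertex set $Q_n$ whose simplices are the nonempty subsets $\sigma\subseteq Q_n$ of diameter at most $r$, i.e. $d_H(a,b)\leq r$ for all $a,b\in\sigma$. A space is $(k-1)$-connected if it is nonempty and its homotopy groups $\pi_i$ vanish for all $0\leq i\leq k-1$ (for $k=0$ this just means nonempty). *)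

theory Defs
  imports "HOL-Analysis.Analysis"
begin

definition hypercube :: "nat \<Rightarrow> bool list set" where
  "hypercube n = {xs. length xs = n}"

text \<open>Only meaningful for lists of equal length.\<close>

definition hamming :: "'a list \<Rightarrow> 'a list \<Rightarrow> nat" where
  "hamming xs ys = card {i. i < length xs \<and> xs ! i \<noteq> ys ! i}"

definition vietoris_rips :: "('a \<Rightarrow> 'a \<Rightarrow> nat) \<Rightarrow> 'a set \<Rightarrow> nat \<Rightarrow> 'a set set" where
  "vietoris_rips d V r =
     {\<sigma>. \<sigma> \<noteq> {} \<and> finite \<sigma> \<and> \<sigma> \<subseteq> V \<and> (\<forall>a\<in>\<sigma>. \<forall>b\<in>\<sigma>. d a b \<le> r)}"

text \<open>
  Geometric realization of a simplicial complex (given by its nonempty finite simplices):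
  a point is its family of barycentric coordinates, extended by zero. The topology is that of
  pointwise convergence, which is the usual one only for complexes with finitely many vertices.
\<close>

definition geometric_realization :: "'a set set \<Rightarrow> ('a \<Rightarrow> real) topology" where
  "geometric_realization K =
     subtopology (powertop_real UNIV)
       {x. (\<forall>v. 0 \<le> x v) \<and> {v. x v \<noteq> 0} \<in> K \<and> (\<Sum>v\<in>{v. x v \<noteq> 0}. x v) = 1}"

text \<open>
  The underlying set of the \<open>i\<close>-th homotopy group of \<open>X\<close> at \<open>x\<close>: based maps from the \<open>i\<close>-sphere
  modulo based homotopy. For \<open>i = 0\<close> the sphere is \<open>{1, -1}\<close>, and the classes are the
  path components of \<open>X\<close>.
\<close>

definition sphere_base :: "nat \<Rightarrow> real" where
  "sphere_base = (\<lambda>j. if j = 0 then 1 else 0)"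

definition homotopy_group_set :: "nat \<Rightarrow> 'a topology \<Rightarrow> 'a \<Rightarrow> ((nat \<Rightarrow> real) \<Rightarrow> 'a) set set" where
  "homotopy_group_set i X x =
     {f. continuous_map (nsphere i) X f \<and> f sphere_base = x} //
     {(f, g). homotopic_with (\<lambda>h. h sphere_base = x) (nsphere i) X f g}"

text \<open>The index is an integer so that \<open>(-1)\<close>-connected means nonempty.\<close>

definition n_connected_space :: "int \<Rightarrow> 'a topology \<Rightarrow> bool" where
  "n_connected_space m X \<longleftrightarrow>
     topspace X \<noteq> {} \<and>
     (\<forall>i. int i \<le> m \<longrightarrow> (\<forall>x\<in>topspace X. is_singleton (homotopy_group_set i X x)))"

end

theory Submission
  imports Defs
begin

text \<open>
  Call two vertices adjacent if their distance is at most \<open>r\<close>. A vertex has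
  \<open>m = \<Sum>i>r. n choose i\<close> non-neighbours and \<open>2 k m < 2 ^ n\<close>, so any \<open>2 k\<close> vertices have a common
  neighbour. A clique complex with this property is \<open>(k - 1)\<close>-connected: it is built by attaching
  vertex stars, which are cones, one after the other, and each star meets the union of the previous
  ones in a union of intersections of two stars, where any \<open>2 k - 2\<close> vertices still have a common
  neighbour. Induction thus reduces the claim to the gluing principle that a union of two
  \<open>j\<close>-connected open sets with \<open>(j - 1)\<close>-connected intersection is \<open>j\<close>-connected.
  Connectedness is expressed through extending maps from the boundary of a cube to the cube, and
  gluing is proved directly by subdividing the boundary of the cube.
\<close>

section \<open>Grid cells and extension of maps\<close>

text \<open>The gluing principle is the place where van Kampen, Mayer-Vietoris and Hurewicz would
  usually be combined. An extension property quantified over all grid cells treats every degree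
  alike and keeps base points out until the homotopy groups are reached. Cells of a subdivision can
  then be filled where they stand, without moving them to a standard cube. A Lebesgue number
  argument needs open sets, but the stars of a complex are closed. The complex is therefore replaced
  by open sets \<open>thick W\<close> of vectors whose nonnegative coordinates form a clique, for
  which stars and their overlaps are again sets of the same kind. The induction cannot speak of
  clique complexes alone: an overlap is a union of pieces whose centres may lie outside the current
  vertex set \<open>W\<close>, so these pieces need not be cones. Hence the second family
  \<open>star_union W S\<close>, and a notion of domination that tests vertices of all of
  \<open>V\<close> while the common neighbour is sought in \<open>W\<close>.\<close>

text \<open>Cells of the integer grid in doubled coordinates: an even \<open>c i\<close> stands for the point \<open>c i / 2\<close>,
  an odd one for the unit interval centred at \<open>c i / 2\<close>.\<close>

definition cell :: "(nat \<Rightarrow> int) \<Rightarrow> (nat \<Rightarrow> real) set" where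
  "cell c = {x. \<forall>i. if odd (c i) then \<bar>2 * x i - of_int (c i)\<bar> \<le> 1 else 2 * x i = of_int (c i)}"

definition rim :: "(nat \<Rightarrow> int) \<Rightarrow> (nat \<Rightarrow> real) set" where
  "rim c = {x \<in> cell c. \<exists>i. odd (c i) \<and> \<bar>2 * x i - of_int (c i)\<bar> = 1}"

definition axes :: "(nat \<Rightarrow> int) \<Rightarrow> nat set" where
  "axes c = {i. odd (c i)}"

text \<open>In doubled coordinates the ends of the interval of an odd entry are its two even
  neighbours. A cell is a face of itself, so proper faces are singled out by their
  \<open>axes\<close>.\<close>

definition face :: "(nat \<Rightarrow> int) \<Rightarrow> (nat \<Rightarrow> int) \<Rightarrow> bool" where
  "face c e \<longleftrightarrow> (\<forall>i. c i = e i \<or> odd (e i) \<and> \<bar>c i - e i\<bar> = 1)"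

text \<open>For finitely many axes the rim is a sphere of one dimension less, so this is the
  vanishing of one homotopy set, without base points. A cell without axes has empty rim, and then
  the condition says that \<open>Y\<close> is nonempty.\<close>

definition extends_over :: "(nat \<Rightarrow> int) \<Rightarrow> 'b::topological_space set \<Rightarrow> bool" where
  "extends_over c Y \<longleftrightarrow>
     (\<forall>f. continuous_on (rim c) f \<and> f ` rim c \<subseteq> Y \<longrightarrow>
        (\<exists>g. continuous_on (cell c) g \<and> g ` cell c \<subseteq> Y \<and> (\<forall>x\<in>rim c. g x = f x)))"

text \<open>For \<open>q = j + 2\<close> this is \<open>j\<close>-connectedness.\<close>

definition cell_connected :: "nat \<Rightarrow> 'b::topological_space set \<Rightarrow> bool" where
  "cell_connected q Y \<longleftrightarrow>
     (\<forall>c. finite (axes c) \<and> card (axes c) < q \<longrightarrow> extends_over c Y)"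

lemma extends_overD:
  assumes "extends_over c Y" "continuous_on (rim c) f" "f ` rim c \<subseteq> Y"
  shows "\<exists>g. continuous_on (cell c) g \<and> g ` cell c \<subseteq> Y \<and> (\<forall>x\<in>rim c. g x = f x)"
  using assms by (simp add: extends_over_def)

lemma continuous_on_coordinate [continuous_intros]:
  "continuous_on S (\<lambda>x::'a \<Rightarrow> 'b::topological_space. x i)"
  by (rule continuous_on_subset[OF continuous_on_product_coordinates]) simp

lemma cellI:
  assumes "\<And>i. odd (c i) \<Longrightarrow> \<bar>2 * x i - of_int (c i)\<bar> \<le> 1"
    and "\<And>i. even (c i) \<Longrightarrow> 2 * x i = of_int (c i)"
  shows "x \<in> cell c"
  using assms by (simp add: cell_def)

lemma cell_odd: "x \<in> cell c \<Longrightarrow> odd (c i) \<Longrightarrow> \<bar>2 * x i - of_int (c i)\<bar> \<le> 1"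
  unfolding cell_def mem_Collect_eq by (metis (mono_tags))

lemma cell_even: "x \<in> cell c \<Longrightarrow> even (c i) \<Longrightarrow> 2 * x i = of_int (c i)"
  unfolding cell_def mem_Collect_eq by (metis (mono_tags))

lemma rim_subset_cell: "rim c \<subseteq> cell c"
  by (auto simp: rim_def)

text \<open>A product of intervals and points, so that Tychonoff gives compactness in spite of
  infinitely many coordinates.\<close>

lemma cell_PiE:
  "cell c = PiE UNIV (\<lambda>i. if odd (c i) then {(of_int (c i) - 1) / 2..(of_int (c i) + 1) / 2} else {of_int (c i) / 2})"
proof -
  have "(if odd (c i) then \<bar>2 * (x i :: real) - of_int (c i)\<bar> \<le> 1 else 2 * x i = of_int (c i)) \<longleftrightarrow>
     x i \<in> (if odd (c i) then {(of_int (c i) - 1) / 2..(of_int (c i) + 1) / 2} else {of_int (c i) / 2})" for x i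
    by (auto simp: field_simps)
  then show ?thesis
    unfolding cell_def PiE_UNIV_domain Pi_def by auto
qed

lemma compact_cell: "compact (cell c)"
proof -
  have "compactin (product_topology (\<lambda>i. euclideanreal) UNIV) (cell c)"
    unfolding cell_PiE compactin_PiE by auto
  then show ?thesis
    by (simp add: euclidean_product_topology)
qed

lemma closed_cell: "closed (cell c)"
proof -
  have "cell c = (\<Inter>i. {x. if odd (c i) then \<bar>2 * x i - of_int (c i)\<bar> \<le> 1 else 2 * x i = of_int (c i)})"
    by (auto simp: cell_def)
  moreover have "closed {x::nat \<Rightarrow> real. if odd (c i) then \<bar>2 * x i - of_int (c i)\<bar> \<le> 1 else 2 * x i = of_int (c i)}" for i
    by (cases "odd (c i)") (auto intro!: closed_Collect_le closed_Collect_eq continuous_intros)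
  ultimately show ?thesis by (metis (no_types, lifting) closed_INT)
qed

lemma closed_rim:
  assumes "finite (axes c)"
  shows "closed (rim c)"
proof -
  have "rim c = (\<Union>i\<in>axes c. cell c \<inter> {x. \<bar>2 * x i - of_int (c i)\<bar> = 1})"
    by (auto simp: rim_def axes_def)
  moreover have "closed (\<Union>i\<in>axes c. cell c \<inter> {x::nat \<Rightarrow> real. \<bar>2 * x i - of_int (c i)\<bar> = 1})"
    using assms by (intro closed_UN ballI closed_Int closed_cell closed_Collect_eq continuous_intros)
  ultimately show ?thesis by simp
qed

lemma compact_rim: "finite (axes c) \<Longrightarrow> compact (rim c)"
  using closed_rim compact_cell rim_subset_cell
  by (metis compact_Int_closed inf.absorb_iff2)

section \<open>The face relation on grid cells\<close>

lemma face_cell_subset: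
  assumes "face c e"
  shows "cell c \<subseteq> cell e"
proof
  fix x assume x: "x \<in> cell c"
  have fc: "c i = e i \<or> odd (e i) \<and> \<bar>c i - e i\<bar> = 1" for i
    using assms by (simp add: face_def)
  show "x \<in> cell e"
  proof (rule cellI)
    fix i assume o: "odd (e i)"
    show "\<bar>2 * x i - of_int (e i)\<bar> \<le> 1"
    proof (cases "c i = e i")
      case True then show ?thesis using cell_odd[OF x, of i] o by simp
    next
      case False
      then have 1: "\<bar>c i - e i\<bar> = 1" using fc[of i] by auto
      then have "even (c i)" using o by presburger
      moreover have "\<bar>real_of_int (c i) - of_int (e i)\<bar> = 1" using 1 by linarith
      ultimately show ?thesis using cell_even[OF x, of i] by simp
    qed
  next
    fix i assume "even (e i)"
    then show "2 * x i = of_int (e i)" using fc[of i] cell_even[OF x, of i] by simp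
  qed
qed

text \<open>In each coordinate the entries of \<open>c\<close> and \<open>e\<close> differ by less
  than 2, and parity decides the rest. This is what makes a newly filled cell meet the earlier ones
  only along its rim.\<close>

lemma face_if_interior_meets:
  assumes x: "x \<in> cell c" "x \<notin> rim c" and e: "x \<in> cell e"
  shows "face c e"
  unfolding face_def
proof
  fix i
  note ei = cell_odd[OF e, of i] cell_even[OF e, of i]
  have "\<bar>2 * x i - of_int (c i)\<bar> \<noteq> 1" if "odd (c i)"
    using x that by (auto simp: rim_def)
  then have ci: "odd (c i) \<Longrightarrow> \<bar>2 * x i - of_int (c i)\<bar> < 1" "even (c i) \<Longrightarrow> 2 * x i = of_int (c i)"
    using cell_odd[OF x(1), of i] cell_even[OF x(1), of i] by auto
  show "c i = e i \<or> odd (e i) \<and> \<bar>c i - e i\<bar> = 1"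
  proof (cases "odd (c i)"; cases "odd (e i)")
    assume o: "odd (c i)" "odd (e i)"
    then have "\<bar>real_of_int (c i) - of_int (e i)\<bar> < 2" using ei ci by linarith
    then have "\<bar>c i - e i\<bar> < 2" by linarith
    with o show ?thesis by presburger
  next
    assume o: "odd (c i)" "\<not> odd (e i)"
    then have "\<bar>real_of_int (c i) - of_int (e i)\<bar> < 1" using ei ci by linarith
    then show ?thesis by linarith
  next
    assume o: "\<not> odd (c i)" "odd (e i)"
    then have "\<bar>real_of_int (c i) - of_int (e i)\<bar> \<le> 1" using ei ci by linarith
    then have "\<bar>c i - e i\<bar> \<le> 1" by linarith
    with o show ?thesis by presburger
  next
    assume o: "\<not> odd (c i)" "\<not> odd (e i)"
    then show ?thesis using ei ci by simp
  qed
qed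

lemma face_axes_subset: "face c e \<Longrightarrow> axes c \<subseteq> axes e"
  by (force simp: face_def axes_def)

text \<open>Moving an odd entry to a neighbour makes it even, so a proper face loses an
  axis.\<close>

lemma face_eq_if_axes_eq:
  assumes "face c e" "axes c = axes e"
  shows "c = e"
proof
  fix i
  have "odd (c i) = odd (e i)" using assms(2) by (auto simp: axes_def set_eq_iff)
  moreover have "c i = e i \<or> odd (e i) \<and> \<bar>c i - e i\<bar> = 1" using assms(1) by (simp add: face_def)
  ultimately show "c i = e i" by presburger
qed

lemma rim_imp_proper_face:
  assumes "x \<in> rim c"
  obtains e where "face e c" "axes e \<subset> axes c" "x \<in> cell e"
proof -
  obtain i where i: "odd (c i)" "\<bar>2 * x i - of_int (c i)\<bar> = 1" and x: "x \<in> cell c"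
    using assms by (auto simp: rim_def)
  \<comment> \<open>The end of the \<open>i\<close>-th interval at which \<open>x\<close> lies; the
    entry \<open>c i + s\<close> is even and fixes that end.\<close>
  define s :: int where "s = (if 2 * x i - of_int (c i) = 1 then 1 else -1)"
  have s: "2 * x i = of_int (c i + s)" "\<bar>s\<bar> = 1" using i by (auto simp: s_def)
  have ev: "even (c i + s)" using s(2) i(1) by presburger
  show thesis
  proof
    show "face (c(i := c i + s)) c" using i s by (auto simp: face_def)
    show "axes (c(i := c i + s)) \<subset> axes c" using i ev by (auto simp: axes_def)
    show "x \<in> cell (c(i := c i + s))" using x s ev by (auto simp: cell_def)
  qed
qed

text \<open>The extension proceeds one cell at a time, in order of increasing dimension; the targets
  \<open>T c\<close> play the role of a carrier.\<close>

lemma extend_along_carrier: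
  fixes f :: "(nat \<Rightarrow> real) \<Rightarrow> 'b::topological_space"
  assumes finC: "finite C" and DC: "D \<subseteq> C"
    and faceC: "\<And>c e. e \<in> C \<Longrightarrow> face c e \<Longrightarrow> c \<in> C"
    and faceD: "\<And>c e. e \<in> D \<Longrightarrow> face c e \<Longrightarrow> c \<in> D"
    and finax: "\<And>c. c \<in> C \<Longrightarrow> finite (axes c)"
    and mono: "\<And>c e. e \<in> C \<Longrightarrow> face c e \<Longrightarrow> T c \<subseteq> T e"
    and ext: "\<And>c. c \<in> C - D \<Longrightarrow> extends_over c (T c)"
    and contf: "continuous_on (\<Union>(cell ` D)) f"
    and fT: "\<And>c. c \<in> D \<Longrightarrow> f ` cell c \<subseteq> T c"
  shows "\<exists>g. continuous_on (\<Union>(cell ` C)) g \<and> (\<forall>c\<in>C. g ` cell c \<subseteq> T c) \<and>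
             (\<forall>x\<in>\<Union>(cell ` D). g x = f x)"
  using DC faceD ext contf fT
proof (induction "card (C - D)" arbitrary: D f)
  case 0
  then have "C = D" using finC by auto
  then show ?case using 0 by (intro exI[of _ f]) auto
next
  case (Suc n)
  have finD: "finite D" using Suc.prems(1) finC finite_subset by blast
  have ne: "C - D \<noteq> {}" using Suc.hyps(2) by (metis card.empty nat.distinct(1))
  \<comment> \<open>Least dimension among the missing cells: all proper faces are already in
    \<open>D\<close>, so \<open>f\<close> is defined on the whole rim.\<close>
  define c where "c = arg_min_on (\<lambda>c. card (axes c)) (C - D)"
  have c: "c \<in> C" "c \<notin> D"
    using arg_min_if_finite(1)[of "C - D" "\<lambda>c. card (axes c)"] finC ne by (auto simp: c_def)
  have cmin: "card (axes c) \<le> card (axes e)" if "e \<in> C - D" for e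
    using arg_min_least[of "C - D" e "\<lambda>c. card (axes c)"] finC ne that by (auto simp: c_def)
  have proper: "e \<in> D" if "face e c" "e \<noteq> c" for e
  proof (rule ccontr)
    assume "e \<notin> D"
    then have "e \<in> C - D" using faceC c that by auto
    then have "card (axes c) \<le> card (axes e)" using cmin by simp
    moreover have "axes e \<subset> axes c"
      using face_axes_subset[OF that(1)] face_eq_if_axes_eq[OF that(1)] that(2) by blast
    ultimately show False using psubset_card_mono[OF finax[OF c(1)], of "axes e"] by linarith
  qed
  have rimD: "\<exists>e\<in>D. x \<in> cell e \<and> face e c" if "x \<in> rim c" for x
    using rim_imp_proper_face[OF that] proper by (metis psubset_eq)
  have rim: "rim c \<subseteq> \<Union>(cell ` D)" using rimD by blast
  have "f ` rim c \<subseteq> T c"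
  proof
    fix y assume "y \<in> f ` rim c"
    then obtain x where x: "x \<in> rim c" "y = f x" by auto
    then obtain e where e: "e \<in> D" "x \<in> cell e" "face e c" using rimD by blast
    then have "f x \<in> T e" using Suc.prems(5) by blast
    then show "y \<in> T c" using mono[OF c(1) e(3)] x by auto
  qed
  then obtain g where g: "continuous_on (cell c) g" "g ` cell c \<subseteq> T c" "\<forall>x\<in>rim c. g x = f x"
    using extends_overD[OF Suc.prems(3)[of c] continuous_on_subset[OF Suc.prems(4) rim]] c by blast
  define h where "h = (\<lambda>x. if x \<in> cell c then g x else f x)"
  \<comment> \<open>Off the rim there is nothing to compare: an old cell through \<open>x\<close>
    would have \<open>c\<close> as a face, and \<open>D\<close> is closed under faces.\<close>
  have agree: "g x = f x" if "x \<in> cell c" "x \<in> \<Union>(cell ` D)" for x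
  proof (cases "x \<in> rim c")
    case True then show ?thesis using g by auto
  next
    case False
    from that(2) obtain e where "e \<in> D" "x \<in> cell e" by auto
    then have "c \<in> D" using face_if_interior_meets[OF that(1) False] Suc.prems(2) by blast
    then show ?thesis using c by simp
  qed
  have hf: "h x = f x" if "x \<in> \<Union>(cell ` D)" for x
    using agree that by (auto simp: h_def)
  have conth: "continuous_on (\<Union>(cell ` insert c D)) h"
  proof -
    have "continuous_on (cell c \<union> \<Union>(cell ` D)) h"
      unfolding h_def
      by (rule continuous_on_If[OF closed_cell _ g(1) Suc.prems(4)])
        (use agree finD closed_cell in auto)
    then show ?thesis by simp
  qed
  have "\<exists>k. continuous_on (\<Union>(cell ` C)) k \<and> (\<forall>c\<in>C. k ` cell c \<subseteq> T c) \<and>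
             (\<forall>x\<in>\<Union>(cell ` insert c D). k x = h x)"
  proof (rule Suc.hyps(1)[of "insert c D" h])
    have "C - insert c D = (C - D) - {c}" by auto
    then have "card (C - insert c D) = card (C - D) - 1"
      using c by (metis DiffI card_Diff_singleton)
    then show "n = card (C - insert c D)"
      using Suc.hyps(2) by linarith
    show "a \<in> insert c D" if "e \<in> insert c D" "face a e" for a e
      using that Suc.prems(2) proper by blast
    show "h ` cell e \<subseteq> T e" if "e \<in> insert c D" for e
    proof (cases "e = c")
      case True then show ?thesis using g by (auto simp: h_def)
    next
      case False
      then have "e \<in> D" using that by auto
      then show ?thesis using Suc.prems(5)[of e] hf by fastforce
    qed
    show "insert c D \<subseteq> C" using c Suc.prems(1) by simp
    show "extends_over e (T e)" if "e \<in> C - insert c D" for e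
      using that Suc.prems(3) by simp
  qed (rule conth)
  then obtain k where k: "continuous_on (\<Union>(cell ` C)) k" "\<forall>c\<in>C. k ` cell c \<subseteq> T c"
    "\<forall>x\<in>\<Union>(cell ` insert c D). k x = h x" by blast
  have "k x = f x" if "x \<in> \<Union>(cell ` D)" for x
    using k(3) hf[OF that] that by simp
  then show ?case using k by blast
qed

section \<open>Filling a cell by a null-homotopy\<close>

lemma continuous_on_Max:
  fixes F :: "'i \<Rightarrow> 'x::topological_space \<Rightarrow> real"
  assumes "finite I" "I \<noteq> {}" "\<And>i. i \<in> I \<Longrightarrow> continuous_on S (F i)"
  shows "continuous_on S (\<lambda>x. Max ((\<lambda>i. F i x) ` I))"
  using assms
proof (induction rule: finite_ne_induct)
  case (insert i I)
  have "continuous_on S (\<lambda>x. max (F i x) (Max ((\<lambda>i. F i x) ` I)))"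
    using insert by (intro continuous_on_max) auto
  then show ?case using insert by simp
qed simp

text \<open>In the max norm about the centre, scaled to be 1 on the rim, the collar between radius
  1/2 and 1 carries the homotopy, and the inner cube is sent to \<open>y0\<close>.\<close>

lemma extension_of_nullhomotopic:
  fixes f :: "(nat \<Rightarrow> real) \<Rightarrow> 'b::topological_space" and H :: "real \<times> (nat \<Rightarrow> real) \<Rightarrow> 'b"
  assumes fin: "finite (axes c)" and y0: "y0 \<in> Y"
    and contH: "continuous_on ({0..1} \<times> rim c) H" and HY: "H ` ({0..1} \<times> rim c) \<subseteq> Y"
    and H0: "\<And>x. x \<in> rim c \<Longrightarrow> H (0, x) = f x" and H1: "\<And>x. x \<in> rim c \<Longrightarrow> H (1, x) = y0"
  shows "\<exists>g. continuous_on (cell c) g \<and> g ` cell c \<subseteq> Y \<and> (\<forall>x\<in>rim c. g x = f x)"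
proof (cases "axes c = {}")
  case True
  then have "rim c = {}" by (auto simp: rim_def axes_def)
  then show ?thesis using y0 by (intro exI[of _ "\<lambda>_. y0"]) auto
next
  case False
  define m where "m x = Max ((\<lambda>i. \<bar>2 * x i - of_int (c i)\<bar>) ` axes c)" for x :: "nat \<Rightarrow> real"
  have m_ge: "\<bar>2 * x i - of_int (c i)\<bar> \<le> m x" if "i \<in> axes c" for x i
    unfolding m_def using fin that by (intro Max_ge) auto
  have m_att: "\<exists>i\<in>axes c. m x = \<bar>2 * x i - of_int (c i)\<bar>" for x
    using Max_in[of "(\<lambda>i. \<bar>2 * x i - of_int (c i)\<bar>) ` axes c"] fin False
    unfolding m_def by blast
  have m_le: "m x \<le> 1" if "x \<in> cell c" for x
    using m_att[of x] cell_odd[OF that] by (auto simp: axes_def)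
  have m_rim: "m x = 1" if x: "x \<in> rim c" for x
  proof -
    obtain i where "odd (c i)" "\<bar>2 * x i - of_int (c i)\<bar> = 1" using x by (auto simp: rim_def)
    then have "1 \<le> m x" using m_ge[of i x] by (simp add: axes_def)
    then show ?thesis using m_le[of x] x rim_subset_cell by force
  qed
  have contm: "continuous_on S m" for S
    unfolding m_def using fin False by (intro continuous_on_Max continuous_intros) auto
  define \<rho> where "\<rho> x = (\<lambda>i. (of_int (c i) + (2 * x i - of_int (c i)) / m x) / 2)" for x
  have rho: "\<rho> x \<in> rim c" if x: "x \<in> cell c" and mx: "1/2 \<le> m x" for x
  proof -
    have e: "2 * \<rho> x i - of_int (c i) = (2 * x i - of_int (c i)) / m x" for i
      using mx by (simp add: \<rho>_def field_simps)
    have "\<rho> x \<in> cell c"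
    proof (rule cellI)
      fix i assume "odd (c i)"
      then show "\<bar>2 * \<rho> x i - of_int (c i)\<bar> \<le> 1"
        using m_ge[of i x] mx unfolding e by (simp add: axes_def)
    next
      fix i assume "even (c i)"
      then show "2 * \<rho> x i = of_int (c i)" using cell_even[OF x] by (simp add: \<rho>_def)
    qed
    moreover obtain i where "i \<in> axes c" "m x = \<bar>2 * x i - of_int (c i)\<bar>" using m_att by blast
    then have "odd (c i)" "\<bar>2 * \<rho> x i - of_int (c i)\<bar> = 1" using mx unfolding e by (auto simp: axes_def)
    ultimately show ?thesis by (auto simp: rim_def)
  qed
  have rho_rim: "\<rho> x = x" if "x \<in> rim c" for x
    using m_rim[OF that] by (simp add: \<rho>_def)
  \<comment> \<open>The time \<open>2 - 2 * m x\<close> runs from 0 on the rim to 1 at radius 1/2.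
    Stopping there keeps the division by \<open>m x\<close> in the radial projection \<rho> away
    from the centre.\<close>
  define g where "g x = (if 1/2 \<le> m x then H (2 - 2 * m x, \<rho> x) else y0)" for x
  define A where "A = cell c \<inter> {x. 1/2 \<le> m x}"
  define B where "B = cell c \<inter> {x. m x \<le> 1/2}"
  have cl: "closed A" "closed B"
    unfolding A_def B_def by (intro closed_Int closed_cell closed_Collect_le continuous_intros contm)+
  have in_dom: "(2 - 2 * m x, \<rho> x) \<in> {0..1} \<times> rim c" if "x \<in> A" for x
    using that rho[of x] m_le[of x] by (auto simp: A_def)
  have "continuous_on A (\<lambda>x. H (2 - 2 * m x, \<rho> x))"
  proof (rule continuous_on_compose2[OF contH])
    show "continuous_on A (\<lambda>x. (2 - 2 * m x, \<rho> x))"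
      unfolding \<rho>_def
      by (intro continuous_intros contm) (auto simp: A_def)
  qed (use in_dom in auto)
  moreover have "H (2 - 2 * m x, \<rho> x) = y0" if "x \<in> B" "1/2 \<le> m x" for x
  proof -
    have "2 - 2 * m x = 1" using that by (auto simp: B_def)
    then show ?thesis using H1[OF rho[of x]] that by (auto simp: B_def)
  qed
  ultimately have "continuous_on (A \<union> B) g"
    unfolding g_def using cl by (intro continuous_on_If) (auto simp: A_def)
  moreover have "A \<union> B = cell c" by (auto simp: A_def B_def)
  moreover have "g ` cell c \<subseteq> Y"
  proof clarify
    fix x assume x: "x \<in> cell c"
    show "g x \<in> Y"
    proof (cases "1/2 \<le> m x")
      case True
      then have "(2 - 2 * m x, \<rho> x) \<in> {0..1} \<times> rim c" using in_dom x by (simp add: A_def)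
      then have "H (2 - 2 * m x, \<rho> x) \<in> Y" using HY by blast
      then show ?thesis using True by (simp add: g_def)
    qed (use y0 in \<open>auto simp: g_def\<close>)
  qed
  ultimately show ?thesis
    using H0 by (intro exI[of _ g]) (auto simp: g_def m_rim rho_rim)
qed

lemma cell_connected_mono: "cell_connected q Y \<Longrightarrow> p \<le> q \<Longrightarrow> cell_connected p Y"
  by (auto simp: cell_connected_def)

lemma cell_connected_0: "cell_connected 0 Y"
  by (simp add: cell_connected_def)

lemma cell_connected_nonempty:
  assumes "cell_connected (Suc q) Y"
  shows "Y \<noteq> {}"
proof -
  have e: "axes (\<lambda>_. 0) = {}" "rim (\<lambda>_. 0) = {}" by (auto simp: axes_def rim_def)
  have "extends_over (\<lambda>_. 0) Y"
    using assms e by (auto simp: cell_connected_def)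
  then obtain g where g: "g ` cell (\<lambda>_. 0) \<subseteq> Y"
    unfolding extends_over_def e by (metis continuous_on_empty empty_subsetI image_empty)
  have "(\<lambda>_. 0) \<in> cell (\<lambda>_. 0)" by (simp add: cell_def)
  then show ?thesis using g by blast
qed

section \<open>Gluing\<close>

lemma face_trans:
  assumes "face a b" "face b c"
  shows "face a c"
  unfolding face_def
proof
  fix i
  have "a i = b i \<or> odd (b i) \<and> \<bar>a i - b i\<bar> = 1" "b i = c i \<or> odd (c i) \<and> \<bar>b i - c i\<bar> = 1"
    using assms by (auto simp: face_def)
  then show "a i = c i \<or> odd (c i) \<and> \<bar>a i - c i\<bar> = 1"
    by presburger
qed

text \<open>The metric weights the coordinates by powers of 1/2, whose sum is the factor 2.\<close>

lemma dist_fun_le: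
  fixes x y :: "nat \<Rightarrow> real"
  assumes "\<And>i. \<bar>x i - y i\<bar> \<le> \<delta>"
  shows "dist x y \<le> 2 * \<delta>"
proof -
  have "(\<Sum>n. (1/2)^n * min (dist (x (from_nat n)) (y (from_nat n))) 1) \<le> (\<Sum>n. (1/2)^n * \<delta>)"
  proof (rule suminf_le)
    show "(1/2)^n * min (dist (x (from_nat n)) (y (from_nat n))) 1 \<le> (1/2)^n * \<delta>" for n
      using assms[of "from_nat n"] by (intro mult_left_mono) (auto simp: dist_real_def)
    show "summable (\<lambda>n. (1/2)^n * min (dist (x (from_nat n)) (y (from_nat n))) 1)"
      by (rule summable_comparison_test'[of "\<lambda>n. (1/2)^n"]) (auto simp: summable_geometric_iff)
    show "summable (\<lambda>n. (1/2)^n * \<delta>)"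
      by (intro summable_mult2) (simp add: summable_geometric_iff)
  qed
  also have "\<dots> = 2 * \<delta>"
    using suminf_mult2[of "\<lambda>n. (1/2::real)^n" \<delta>] suminf_geometric[of "1/2::real"]
    by (simp add: summable_geometric_iff)
  finally show ?thesis by (simp add: dist_fun_def)
qed

text \<open>A Lebesgue number for the preimages of \<open>A\<close> and \<open>B\<close>, stated
  coordinatewise because that is what the mesh of a grid controls. The bound \<epsilon> / 4 on
  coordinates becomes \<epsilon> / 2 in the metric.\<close>

lemma small_sets_map_into_one:
  fixes f :: "(nat \<Rightarrow> real) \<Rightarrow> 'b::topological_space"
  assumes S: "compact S" and contf: "continuous_on S f" and fAB: "f ` S \<subseteq> A \<union> B"
    and "open A" "open B"
  obtains \<delta> where "0 < \<delta>"
    "\<And>T. \<lbrakk>T \<subseteq> S; \<And>x y i. x \<in> T \<Longrightarrow> y \<in> T \<Longrightarrow> \<bar>x i - y i\<bar> \<le> \<delta>\<rbrakk> \<Longrightarrow> f ` T \<subseteq> A \<or> f ` T \<subseteq> B"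
proof -
  obtain A' where A': "open A'" "A' \<inter> S = f -` A \<inter> S"
    using contf \<open>open A\<close> continuous_on_open_invariant by metis
  obtain B' where B': "open B'" "B' \<inter> S = f -` B \<inter> S"
    using contf \<open>open B\<close> continuous_on_open_invariant by metis
  have "S \<subseteq> \<Union>{A', B'}"
  proof
    fix x assume "x \<in> S"
    then have "x \<in> f -` A \<inter> S \<or> x \<in> f -` B \<inter> S" using fAB by blast
    then show "x \<in> \<Union>{A', B'}" unfolding A'(2)[symmetric] B'(2)[symmetric] by blast
  qed
  then obtain \<epsilon> where \<epsilon>: "0 < \<epsilon>" "\<And>x. x \<in> S \<Longrightarrow> \<exists>G\<in>{A', B'}. ball x \<epsilon> \<subseteq> G"
    using Heine_Borel_lemma[OF S, of "{A', B'}"] A'(1) B'(1) by auto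
  show thesis
  proof (rule that[of "\<epsilon> / 4"])
    fix T :: "(nat \<Rightarrow> real) set"
    assume T: "T \<subseteq> S" "\<And>x y i. x \<in> T \<Longrightarrow> y \<in> T \<Longrightarrow> \<bar>x i - y i\<bar> \<le> \<epsilon> / 4"
    show "f ` T \<subseteq> A \<or> f ` T \<subseteq> B"
    proof (cases "T = {}")
      case False
      then obtain x where x: "x \<in> T" by auto
      then obtain G where G: "G \<in> {A', B'}" "ball x \<epsilon> \<subseteq> G" using \<epsilon>(2)[of x] T(1) by auto
      have "T \<subseteq> ball x \<epsilon>"
      proof
        fix y assume "y \<in> T"
        then have "dist x y \<le> 2 * (\<epsilon> / 4)" using T(2) x by (intro dist_fun_le) auto
        then show "y \<in> ball x \<epsilon>" using \<epsilon>(1) by simp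
      qed
      then have "T \<subseteq> A' \<inter> S \<or> T \<subseteq> B' \<inter> S" using G T(1) by auto
      then show ?thesis using A' B' by auto
    qed simp
  qed (use \<epsilon> in simp)
qed

text \<open>The boundary of a cube is cut into small cells, each mapped into \<open>A\<close> or \<open>B\<close>. Carrying
  a cell that lies both in a top-dimensional cell mapped into \<open>A\<close> and in one that is not
  along \<open>A \<inter> B\<close>, the given map is joined to a constant over the cylinder; such
  cells have codimension at least one, hence the weaker requirement on \<open>A \<inter> B\<close>.\<close>

lemma cell_connected_Un:
  fixes A B :: "'b::topological_space set"
  assumes A: "open A" "cell_connected (Suc q) A" and B: "open B" "cell_connected (Suc q) B"
    and AB: "cell_connected q (A \<inter> B)"
  shows "cell_connected (Suc q) (A \<union> B)"
  unfolding cell_connected_def extends_over_def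
proof (intro allI impI, elim conjE)
  fix z :: "nat \<Rightarrow> int" and f :: "(nat \<Rightarrow> real) \<Rightarrow> 'b"
  assume finz: "finite (axes z)" and cardz: "card (axes z) < Suc q"
    and contf: "continuous_on (rim z) f" and fim: "f ` rim z \<subseteq> A \<union> B"
  define D where "D = axes z"
  note finD = finz[folded D_def] and cardD = cardz[folded D_def]
  show "\<exists>g. continuous_on (cell z) g \<and> g ` cell z \<subseteq> A \<union> B \<and> (\<forall>x\<in>rim z. g x = f x)"
  proof (cases "D = {}")
    case True
    then have "rim z = {}" by (auto simp: D_def rim_def axes_def)
    moreover obtain a where "a \<in> A" using cell_connected_nonempty[OF A(2)] by auto
    ultimately show ?thesis by (intro exI[of _ "\<lambda>_. a"]) auto
  next
    case False
    then have cardD0: "0 < card D" using finD by (simp add: card_gt_0_iff)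
    then obtain q' where "q = Suc q'" using cardD by (cases q) auto
    \<comment> \<open>The constant value at the far end of the cylinder; a point of both sets is
      admissible for every carrier.\<close>
    then obtain x0 where x0: "x0 \<in> A" "x0 \<in> B" using cell_connected_nonempty AB by blast
    obtain \<delta> where \<delta>: "0 < \<delta>"
      "\<And>T. \<lbrakk>T \<subseteq> rim z; \<And>x y i. x \<in> T \<Longrightarrow> y \<in> T \<Longrightarrow> \<bar>x i - y i\<bar> \<le> \<delta>\<rbrakk> \<Longrightarrow> f ` T \<subseteq> A \<or> f ` T \<subseteq> B"
      using small_sets_map_into_one[OF compact_rim[OF finz] contf fim A(1) B(1)] by blast
    obtain N :: nat where N: "1 / \<delta> < real N" using reals_Archimedean2 by blast
    have N0: "0 < real N" using N \<delta>(1) by (smt (verit) divide_pos_pos)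
    have N\<delta>: "1 / real N \<le> \<delta>" using N N0 \<delta>(1) by (simp add: field_simps)
    \<comment> \<open>A coordinate outside \<open>D\<close> serves as the time direction of the
      cylinder.\<close>
    obtain l where l: "l \<notin> D" using finD ex_new_if_finite infinite_UNIV_nat by blast

    \<comment> \<open>Shrinks the grid cube with coordinates from 0 to \<open>N\<close> onto the
      cell \<open>z\<close>, so that unit cells acquire side \<open>1 / N\<close>. The cells in the
      boundary of the grid cube form \<open>G\<close>.\<close>
    define \<phi> where "\<phi> x = (\<lambda>i. if i \<in> D then (of_int (z i) - 1) / 2 + x i / N else of_int (z i) / 2)"
      for x :: "nat \<Rightarrow> real"
    define G where "G = {c. (\<forall>i. (i \<in> D \<longrightarrow> c i \<in> {0..2 * int N}) \<and> (i \<notin> D \<longrightarrow> c i = 0)) \<and>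
                            (\<exists>i\<in>D. c i = 0 \<or> c i = 2 * int N)}"
    define Top where "Top = {e \<in> G. card (axes e) = card D - 1}"
    \<comment> \<open>Membership is decided on top cells rather than by the image of
      \<open>c\<close> itself; only thus does lying in both \<open>P\<close> and \<open>Q\<close>
      force a lower dimension. Cells in \<open>Q\<close> are mapped into \<open>B\<close> by the
      choice of the mesh.\<close>
    define P where "P = {c. \<exists>e\<in>Top. face c e \<and> f ` \<phi> ` cell e \<subseteq> A}"
    define Q where "Q = {c. \<exists>e\<in>Top. face c e \<and> \<not> f ` \<phi> ` cell e \<subseteq> A}"
    \<comment> \<open>The cylinder over \<open>G\<close>: the entries 0 and 2 at \<open>l\<close>
      are its ends, the entry 1 is the interval between them.\<close>
    define C where "C = {w. w(l := 0) \<in> G \<and> w l \<in> {0, 1, 2}}"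
    define C0 where "C0 = {w \<in> C. w l \<noteq> 1}"
    \<comment> \<open>A face of \<open>w\<close> lies in at least as many top cells, hence under at
      least as many restrictions, which makes \<open>T\<close> monotone.\<close>
    define T where "T w = {y \<in> A \<union> B. (w(l := 0) \<in> P \<longrightarrow> y \<in> A) \<and> (w(l := 0) \<in> Q \<longrightarrow> y \<in> B)}"
      for w :: "nat \<Rightarrow> int"

    have finG: "finite G"
      by (rule finite_subset[OF _ finite_set_of_finite_funs[OF finD, of "{0..2 * int N}" 0]])
        (auto simp: G_def)
    have finC: "finite C"
    proof (rule finite_subset)
      show "C \<subseteq> (\<lambda>(c, s). c(l := s)) ` (G \<times> {0, 1, 2})"
      proof
        fix w assume "w \<in> C"
        then have "w = (\<lambda>(c, s). c(l := s)) (w(l := 0), w l)" "(w(l := 0), w l) \<in> G \<times> {0, 1, 2}"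
          by (auto simp: C_def)
        then show "w \<in> (\<lambda>(c, s). c(l := s)) ` (G \<times> {0, 1, 2})" by (rule image_eqI)
      qed
    qed (use finG in auto)
    have faceG: "c \<in> G" if e: "e \<in> G" and ce: "face c e" for c e
    proof -
      have fc: "c i = e i \<or> odd (e i) \<and> \<bar>c i - e i\<bar> = 1" for i
        using ce by (simp add: face_def)
      obtain i0 where i0: "i0 \<in> D" "e i0 = 0 \<or> e i0 = 2 * int N" using e by (auto simp: G_def)
      then have "c i0 = e i0" using fc[of i0] by auto
      moreover have "c i \<in> {0..2 * int N}" if "i \<in> D" for i
      proof -
        have "e i \<in> {0..2 * int N}" using e that by (auto simp: G_def)
        then show ?thesis using fc[of i] by (simp, presburger)
      qed
      moreover have "c i = 0" if "i \<notin> D" for i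
        using e that fc[of i] by (auto simp: G_def)
      ultimately show ?thesis using i0 by (auto simp: G_def)
    qed
    have face_upd: "face (v(l := 0)) (w(l := 0))" if "face v w" for v w
      using that by (auto simp: face_def)
    have faceC: "v \<in> C" if w: "w \<in> C" and vw: "face v w" for v w
    proof -
      have "v l = w l \<or> odd (w l) \<and> \<bar>v l - w l\<bar> = 1" using vw by (simp add: face_def)
      then have "v l \<in> {0, 1, 2}" using w by (auto simp: C_def)
      then show ?thesis using faceG[OF _ face_upd[OF vw]] w by (simp add: C_def)
    qed
    have faceC0: "v \<in> C0" if w: "w \<in> C0" and vw: "face v w" for v w
    proof -
      have "v l = w l \<or> odd (w l) \<and> \<bar>v l - w l\<bar> = 1" using vw by (simp add: face_def)
      moreover have "w l = 0 \<or> w l = 2" using w by (auto simp: C_def C0_def)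
      ultimately have "v l \<noteq> 1" by auto
      then show ?thesis using faceC[OF _ vw] w by (simp add: C0_def)
    qed
    have axesG: "card (axes c) \<le> card D - 1 \<and> axes c \<subseteq> D" if c: "c \<in> G" for c
    proof -
      obtain i0 where i0: "i0 \<in> D" "c i0 = 0 \<or> c i0 = 2 * int N" using c by (auto simp: G_def)
      have "c i = 0" if "i \<notin> D" for i using c that by (auto simp: G_def)
      then have "axes c \<subseteq> D" unfolding axes_def by (metis (mono_tags) even_zero mem_Collect_eq subsetI)
      then have "axes c \<subseteq> D - {i0}" using i0 by (auto simp: axes_def)
      then show ?thesis using finD i0(1) card_mono[of "D - {i0}" "axes c"] by auto
    qed
    have axesC: "axes w = axes (w(l := 0)) \<union> (if w l = 1 then {l} else {})" if "w \<in> C" for w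
      using that by (auto simp: axes_def C_def split: if_splits)
    have finaxG: "finite (axes c)" if "c \<in> G" for c
      using axesG[OF that] finD finite_subset by blast
    have finaxC: "finite (axes w)" if "w \<in> C" for w
      using axesC[OF that] finaxG[of "w(l := 0)"] that by (auto simp: C_def)
    have PQ: "c \<in> P \<or> c \<in> Q" if c: "c \<in> G" for c
    proof -
      obtain i0 where i0: "i0 \<in> D" "c i0 = 0 \<or> c i0 = 2 * int N" using c by (auto simp: G_def)
      have cD: "c i \<in> {0..2 * int N}" if "i \<in> D" for i using c that by (auto simp: G_def)
      have cnD: "c i = 0" if "i \<notin> D" for i using c that by (auto simp: G_def)
      \<comment> \<open>Thickens \<open>c\<close> to a top cell: the coordinate \<open>i0\<close>
        stays pinned, every other even entry in \<open>D\<close> moves to an odd neighbour, upwards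
        except at the far end \<open>2 * int N\<close>.\<close>
      define e where "e i = (if i \<notin> D \<or> i = i0 \<or> odd (c i) then c i
                             else if c i = 2 * int N then c i - 1 else c i + 1)" for i
      have "face c e" by (auto simp: face_def e_def)
      have "e i \<in> {0..2 * int N}" if "i \<in> D" for i
        using cD[OF that] N0 by (auto simp: e_def)
      then have "e \<in> G"
        using i0 cnD by (auto simp: G_def e_def)
      moreover have "axes e = D - {i0}"
      proof -
        have "odd (e i) \<longleftrightarrow> i \<in> D \<and> i \<noteq> i0" for i
          using i0 cnD[of i] by (cases "i = i0"; cases "i \<in> D"; cases "c i = 2 * int N") (auto simp: e_def)
        then show ?thesis by (auto simp: axes_def)
      qed
      ultimately have "e \<in> Top" using i0(1) by (simp add: Top_def)
      then show ?thesis using \<open>face c e\<close> by (auto simp: P_def Q_def)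
    qed
    \<comment> \<open>Among top cells, a cell of top dimension is a face of itself only, and
      \<open>P\<close> and \<open>Q\<close> ask for opposite behaviour of that cell.\<close>
    have PQ_dim: "card (axes c) < card D - 1" if c: "c \<in> P" "c \<in> Q" for c
    proof (rule ccontr)
      assume neg: "\<not> card (axes c) < card D - 1"
      have eq: "c = e" if "e \<in> Top" "face c e" for e
      proof (rule face_eq_if_axes_eq[OF that(2)])
        have "e \<in> G" "card (axes e) = card D - 1" using that by (auto simp: Top_def)
        then show "axes c = axes e"
          using neg face_axes_subset[OF that(2)] finaxG[of e] card_subset_eq card_mono
          by (metis le_antisym linorder_not_less)
      qed
      obtain e where "e \<in> Top" "face c e" "f ` \<phi> ` cell e \<subseteq> A" using c(1) by (auto simp: P_def)
      moreover obtain e' where "e' \<in> Top" "face c e'" "\<not> f ` \<phi> ` cell e' \<subseteq> A"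
        using c(2) unfolding Q_def by blast
      ultimately show False using eq by metis
    qed
    have mono: "T v \<subseteq> T w" if "w \<in> C" "face v w" for v w
      using face_trans[OF face_upd[OF that(2)]] unfolding T_def P_def Q_def by blast
    have ext: "extends_over w (T w)" if w: "w \<in> C - C0" for w
    proof -
      define c where "c = w(l := 0)"
      have c: "c \<in> G" and wl: "w l = 1" using w by (auto simp: C_def C0_def c_def)
      have "axes w = insert l (axes c)" using axesC[of w] w wl by (auto simp: c_def)
      moreover have "l \<notin> axes c" by (simp add: c_def axes_def)
      ultimately have card: "card (axes w) = Suc (card (axes c))" using finaxG[OF c] by simp
      have fin: "finite (axes w)" using finaxC w by simp
      show ?thesis
      proof (cases "c \<in> P \<and> c \<in> Q")
        case True
        then have "T w = A \<inter> B" by (auto simp: T_def c_def)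
        \<comment> \<open>The time axis adds one dimension; the codimension from
          \<open>PQ_dim\<close> compensates for it, so the weaker hypothesis on the intersection
          suffices.\<close>
        moreover have "card (axes w) < q" using PQ_dim[of c] True card cardD by linarith
        ultimately show ?thesis using AB fin by (simp add: cell_connected_def)
      next
        case False
        then have "T w = A \<or> T w = B" using PQ[OF c] by (auto simp: T_def c_def)
        moreover have "card (axes w) < Suc q" using axesG[OF c] card cardD cardD0 by linarith
        ultimately show ?thesis using A(2) B(2) fin by (auto simp: cell_connected_def)
      qed
    qed

    have cellD: "0 \<le> x i \<and> x i \<le> real N" if w: "w \<in> C" and x: "x \<in> cell w" and i: "i \<in> D" for w x i
    proof -
      have wi: "w i \<in> {0..2 * int N}" using w i l by (auto simp: C_def G_def split: if_splits)
      show ?thesis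
      proof (cases "odd (w i)")
        case True
        then have "1 \<le> w i" "w i \<le> 2 * int N - 1" using wi by (simp, presburger)+
        then have "1 \<le> real_of_int (w i)" "real_of_int (w i) \<le> 2 * real N - 1" by linarith+
        then show ?thesis using cell_odd[OF x True] by linarith
      next
        case False
        have "0 \<le> real_of_int (w i)" "real_of_int (w i) \<le> 2 * real N" using wi by simp_all
        then show ?thesis using cell_even[OF x, of i] False by simp
      qed
    qed
    have \<phi>D: "2 * \<phi> x i - of_int (z i) = 2 * x i / N - 1" if "i \<in> D" for x i
      using that by (simp add: \<phi>_def field_simps)
    have \<phi>rim: "\<phi> x \<in> rim z" if w: "w \<in> C" and x: "x \<in> cell w" for w x
    proof -
      have "\<phi> x \<in> cell z"
      proof (rule cellI)
        fix i assume "odd (z i)"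
        then have i: "i \<in> D" by (simp add: D_def axes_def)
        show "\<bar>2 * \<phi> x i - of_int (z i)\<bar> \<le> 1"
          unfolding \<phi>D[OF i] using cellD[OF w x i] N0 by (simp add: abs_le_iff field_simps)
      next
        fix i assume "even (z i)"
        then show "2 * \<phi> x i = of_int (z i)" by (simp add: \<phi>_def D_def axes_def)
      qed
      moreover obtain i where i: "i \<in> D" "w i = 0 \<or> w i = 2 * int N"
        using w l by (auto simp: C_def G_def split: if_splits)
      then have "even (w i)" by auto
      then have "x i = 0 \<or> x i = real N" using cell_even[OF x, of i] i(2) by auto
      then have "\<bar>2 * \<phi> x i - of_int (z i)\<bar> = 1"
        unfolding \<phi>D[OF i(1)] using N0 by auto
      ultimately show ?thesis using i(1) by (auto simp: rim_def D_def axes_def)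
    qed
    have GC: "c \<in> C \<and> c(l := 0) = c" if "c \<in> G" for c
    proof -
      have "c l = 0" using that l by (auto simp: G_def)
      then have "c(l := 0) = c" by (auto simp: fun_eq_iff)
      then show ?thesis using that \<open>c l = 0\<close> by (simp add: C_def)
    qed
    have small: "f ` \<phi> ` cell c \<subseteq> A \<or> f ` \<phi> ` cell c \<subseteq> B" if c: "c \<in> G" for c
    proof (rule \<delta>(2))
      show "\<phi> ` cell c \<subseteq> rim z" using \<phi>rim GC[OF c] by blast
    next
      fix x' y' i assume "x' \<in> \<phi> ` cell c" "y' \<in> \<phi> ` cell c"
      then obtain x y where xy: "x \<in> cell c" "y \<in> cell c" "x' = \<phi> x" "y' = \<phi> y" by auto
      have "\<bar>x i - y i\<bar> \<le> 1"
      proof (cases "odd (c i)")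
        case True
        then show ?thesis using cell_odd[OF xy(1) True] cell_odd[OF xy(2) True] by linarith
      next
        case False
        then show ?thesis using cell_even[OF xy(1), of i] cell_even[OF xy(2), of i] by simp
      qed
      then have "\<bar>x i - y i\<bar> / N \<le> 1 / N" using N0 by (simp add: divide_right_mono)
      then have "\<bar>(x i - y i) / N\<bar> \<le> \<delta>" using N\<delta> by simp
      then show "\<bar>x' i - y' i\<bar> \<le> \<delta>"
        using \<delta>(1) by (simp add: xy \<phi>_def diff_divide_distrib)
    qed

    define f0 where "f0 x = (if x l = 0 then f (\<phi> x) else x0)" for x
    have lC: "2 * x l = of_int (w l)" if "w \<in> C0" "x \<in> cell w" for w x
      using that cell_even[of x w l] by (auto simp: C0_def C_def)
    have f0T: "f0 ` cell w \<subseteq> T w" if w: "w \<in> C0" for w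
    proof clarify
      fix x assume x: "x \<in> cell w"
      show "f0 x \<in> T w"
      proof (cases "x l = 0")
        case False then show ?thesis using x0 by (simp add: f0_def T_def)
      next
        case True
        have wC: "w \<in> C" using w by (simp add: C0_def)
        have "w l = 0" using lC[OF w x] True by simp
        then have w0: "w(l := 0) = w" by (auto simp: fun_eq_iff)
        have "f (\<phi> x) \<in> A" if wP: "w \<in> P"
        proof -
          obtain e where e: "e \<in> Top" "face w e" "f ` \<phi> ` cell e \<subseteq> A" using wP by (auto simp: P_def)
          then show ?thesis using face_cell_subset[OF e(2)] x by blast
        qed
        moreover have "f (\<phi> x) \<in> B" if wQ: "w \<in> Q"
        proof -
          obtain e where e: "e \<in> Top" "face w e" "\<not> f ` \<phi> ` cell e \<subseteq> A"
            using wQ unfolding Q_def by blast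
          then have "f ` \<phi> ` cell e \<subseteq> B" using small[of e] by (auto simp: Top_def)
          then show ?thesis using face_cell_subset[OF e(2)] x by blast
        qed
        moreover have "f (\<phi> x) \<in> A \<union> B" using \<phi>rim[OF wC x] fim by blast
        ultimately show ?thesis using True by (simp add: f0_def T_def w0)
      qed
    qed
    have cont\<phi>: "continuous_on S \<phi>" for S
    proof -
      have "continuous_on S (\<lambda>x. \<phi> x i)" for i
        unfolding \<phi>_def using N0 by (cases "i \<in> D") (auto intro!: continuous_intros)
      then show ?thesis by (rule continuous_on_coordinatewise_then_product)
    qed
    have contf0: "continuous_on (\<Union>(cell ` C0)) f0"
    proof -
      define E0 where "E0 = \<Union>(cell ` {w \<in> C0. w l = 0})"
      define E1 where "E1 = \<Union>(cell ` {w \<in> C0. w l = 2})"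
      have finC0: "finite C0" using finC by (simp add: C0_def)
      have "closed E0" "closed E1"
        unfolding E0_def E1_def using finC0 closed_cell by (intro closed_Union; auto)+
      moreover have "continuous_on E0 (\<lambda>x. f (\<phi> x))"
        by (rule continuous_on_compose2[OF contf cont\<phi>]) (use \<phi>rim in \<open>auto simp: E0_def C0_def\<close>)
      moreover have "x l = 0" if "x \<in> E0" for x using that lC by (force simp: E0_def)
      moreover have "x l \<noteq> 0" if "x \<in> E1" for x using that lC by (force simp: E1_def)
      ultimately have "continuous_on (E0 \<union> E1) f0"
        unfolding f0_def by (intro continuous_on_If) auto
      moreover have "\<Union>(cell ` C0) = E0 \<union> E1" by (auto simp: E0_def E1_def C0_def C_def)
      ultimately show ?thesis by simp
    qed
    have "\<exists>g. continuous_on (\<Union>(cell ` C)) g \<and> (\<forall>c\<in>C. g ` cell c \<subseteq> T c) \<and>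
             (\<forall>x\<in>\<Union>(cell ` C0). g x = f0 x)"
      by (rule extend_along_carrier[OF finC _ faceC faceC0 finaxC mono ext contf0 f0T])
        (auto simp: C0_def)
    then obtain g where contg: "continuous_on (\<Union>(cell ` C)) g"
      and gT: "\<And>c. c \<in> C \<Longrightarrow> g ` cell c \<subseteq> T c" and gf0: "\<And>x. x \<in> \<Union>(cell ` C0) \<Longrightarrow> g x = f0 x"
      by blast

    \<comment> \<open>The inverse of \<phi> on the rim of \<open>z\<close>, placed at time
      \<open>t\<close>.\<close>
    define \<psi> where "\<psi> t y = (\<lambda>i. if i = l then t else if i \<in> D
                               then N * (y i - (of_int (z i) - 1) / 2) else 0)"
      for t :: real and y :: "nat \<Rightarrow> real"
    have \<phi>\<psi>: "\<phi> (\<psi> t y) = y" if y: "y \<in> rim z" for t y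
    proof
      fix i
      show "\<phi> (\<psi> t y) i = y i"
      proof (cases "i \<in> D")
        case True then show ?thesis using l N0 by (auto simp: \<phi>_def \<psi>_def)
      next
        case False
        then have "2 * y i = of_int (z i)"
          using y rim_subset_cell cell_even by (force simp: D_def axes_def)
        then show ?thesis using False by (simp add: \<phi>_def)
      qed
    qed
    \<comment> \<open>The bound says that \<open>t\<close> belongs to the entry \<open>s\<close>:
      any time for \<open>s = 1\<close>, and \<open>t = s / 2\<close> at the ends. One base cell
      serves all times.\<close>
    have locate: "\<exists>c\<in>G. \<forall>t\<in>{0..1}. \<forall>s\<in>{0, 1, 2}. \<bar>2 * t - of_int s\<bar> \<le> of_bool (s = 1) \<longrightarrow>
                    \<psi> t y \<in> cell (c(l := s))"
      if y: "y \<in> rim z" for y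
    proof -
      define x where "x = \<psi> 0 y"
      \<comment> \<open>Integral coordinates get even entries, so a coordinate at 0 or
        \<open>N\<close> stays pinned and \<open>c\<close> lies in the boundary.\<close>
      define c where "c i = (if x i = of_int \<lfloor>x i\<rfloor> then 2 * \<lfloor>x i\<rfloor> else 2 * \<lfloor>x i\<rfloor> + 1)" for i
      have yD: "\<bar>2 * y i - of_int (z i)\<bar> \<le> 1" if "i \<in> D" for i
        using that y rim_subset_cell cell_odd by (force simp: D_def axes_def)
      have xD: "0 \<le> x i \<and> x i \<le> real N" if "i \<in> D" for i
      proof -
        have "0 \<le> y i - (of_int (z i) - 1) / 2" "y i - (of_int (z i) - 1) / 2 \<le> 1"
          using yD[OF that] by (auto simp: field_simps)
        then show ?thesis using N0 that l mult_left_mono[of "y i - (of_int (z i) - 1) / 2" 1 "real N"]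
          by (auto simp: x_def \<psi>_def)
      qed
      have cD: "c i \<in> {0..2 * int N}" if "i \<in> D" for i
      proof (cases "x i = of_int \<lfloor>x i\<rfloor>")
        case True
        moreover have "0 \<le> \<lfloor>x i\<rfloor>" "\<lfloor>x i\<rfloor> \<le> int N"
          using xD[OF that] by (simp, linarith)
        ultimately show ?thesis by (simp add: c_def)
      next
        case False
        then have "x i \<noteq> real N" by (metis floor_of_nat of_int_of_nat_eq)
        then have "\<lfloor>x i\<rfloor> < int N" using xD[OF that] by (simp add: floor_less_iff)
        then show ?thesis using False xD[OF that] by (simp add: c_def)
      qed
      have x0: "x i = 0" if "i \<notin> D" for i using that by (simp add: x_def \<psi>_def)
      obtain i0 where i0: "odd (z i0)" "\<bar>2 * y i0 - of_int (z i0)\<bar> = 1"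
        using y by (auto simp: rim_def)
      have "i0 \<in> D" using i0(1) by (simp add: D_def axes_def)
      have "y i0 - (of_int (z i0) - 1) / 2 = 0 \<or> y i0 - (of_int (z i0) - 1) / 2 = 1"
        using i0(2) by (auto simp: field_simps abs_if split: if_splits)
      then have "x i0 = 0 \<or> x i0 = real N"
        using \<open>i0 \<in> D\<close> l by (auto simp: x_def \<psi>_def)
      then have "c i0 = 0 \<or> c i0 = 2 * int N" by (auto simp: c_def)
      moreover have "c i = 0" if "i \<notin> D" for i using x0[OF that] by (simp add: c_def)
      ultimately have cG: "c \<in> G" using cD \<open>i0 \<in> D\<close> unfolding G_def by blast
      have "\<psi> t y \<in> cell (c(l := s))"
        if t: "t \<in> {0..1}" and s: "s \<in> {0, 1, 2}" and ts: "\<bar>2 * t - of_int s\<bar> \<le> of_bool (s = 1)" for t s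
      proof (rule cellI)
        fix i assume o: "odd ((c(l := s)) i)"
        show "\<bar>2 * \<psi> t y i - of_int ((c(l := s)) i)\<bar> \<le> 1"
        proof (cases "i = l")
          case True then show ?thesis using ts by (auto simp: \<psi>_def of_bool_def split: if_splits)
        next
          case False
          then have "\<psi> t y i = x i" by (simp add: \<psi>_def x_def)
          moreover have "c i = 2 * \<lfloor>x i\<rfloor> + 1" using o False by (auto simp: c_def split: if_splits)
          ultimately show ?thesis using False by (simp add: abs_le_iff) linarith
        qed
      next
        fix i assume e: "even ((c(l := s)) i)"
        show "2 * \<psi> t y i = of_int ((c(l := s)) i)"
        proof (cases "i = l")
          case True
          then have "s \<noteq> 1" using e by auto
          then show ?thesis using ts True by (auto simp: \<psi>_def)
        next
          case False
          then have "\<psi> t y i = x i" by (simp add: \<psi>_def x_def)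
          moreover have "c i = 2 * \<lfloor>x i\<rfloor>" "x i = of_int \<lfloor>x i\<rfloor>"
            using e False by (auto simp: c_def split: if_splits)
          ultimately show ?thesis using False by (metis fun_upd_apply of_int_mult of_int_numeral)
        qed
      qed
      then show ?thesis using cG by blast
    qed
    have updC: "c(l := s) \<in> C" if "c \<in> G" "s \<in> {0, 1, 2}" for c s
      using that GC[OF that(1)] by (simp add: C_def)
    have in_cyl: "\<exists>w\<in>C. \<psi> t y \<in> cell w" if t: "t \<in> {0..1}" and y: "y \<in> rim z" for t y
    proof -
      have "\<bar>2 * t - of_int 1\<bar> \<le> of_bool ((1::int) = 1)" using t by (simp add: abs_le_iff)
      then obtain c where "c \<in> G" "\<psi> t y \<in> cell (c(l := 1))"
        using locate[OF y] t by blast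
      then show ?thesis using updC[of c 1] by blast
    qed
    have in_ends: "\<exists>w\<in>C0. \<psi> t y \<in> cell w" if t: "t = 0 \<or> t = 1" and y: "y \<in> rim z" for t y
    proof -
      define s :: int where "s = (if t = 0 then 0 else 2)"
      have s: "s \<in> {0, 1, 2}" "\<bar>2 * t - of_int s\<bar> \<le> of_bool (s = 1)" "s \<noteq> 1" "t \<in> {0..1}"
        using t by (auto simp: s_def)
      then obtain c where "c \<in> G" "\<psi> t y \<in> cell (c(l := s))"
        using locate[OF y] by blast
      then show ?thesis using updC[of c s] s by (intro bexI[of _ "c(l := s)"]) (auto simp: C0_def)
    qed
    define H where "H = (\<lambda>(t, y). g (\<psi> t y))"
    show ?thesis
    proof (rule extension_of_nullhomotopic[OF finz])
      show "x0 \<in> A \<union> B" using x0 by simp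
      have "continuous_on ({0..1} \<times> rim z) (\<lambda>p. \<psi> (fst p) (snd p) i)" for i
      proof -
        have "continuous_on ({0..1} \<times> rim z) (\<lambda>p. snd p i)"
          by (rule continuous_on_product_then_coordinatewise[OF continuous_on_snd[OF continuous_on_id]])
        then show ?thesis
          unfolding \<psi>_def by (cases "i = l"; cases "i \<in> D") 
            (auto intro!: continuous_on_mult continuous_on_diff continuous_on_const continuous_on_fst continuous_on_id)
      qed
      then have "continuous_on ({0..1} \<times> rim z) (\<lambda>p. \<psi> (fst p) (snd p))"
        by (rule continuous_on_coordinatewise_then_product)
      moreover have "(\<lambda>p. \<psi> (fst p) (snd p)) ` ({0..1} \<times> rim z) \<subseteq> \<Union>(cell ` C)"
        using in_cyl by fastforce
      ultimately show "continuous_on ({0..1} \<times> rim z) H"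
        unfolding H_def case_prod_beta by (rule continuous_on_compose2[OF contg])
      show "H ` ({0..1} \<times> rim z) \<subseteq> A \<union> B"
      proof clarify
        fix t :: real and y assume "t \<in> {0..1}" "y \<in> rim z" "H (t, y) \<notin> B"
        then obtain w where w: "w \<in> C" "\<psi> t y \<in> cell w" using in_cyl by blast
        then have "g (\<psi> t y) \<in> T w" using gT by blast
        then show "H (t, y) \<in> A" using \<open>H (t, y) \<notin> B\<close> by (simp add: H_def T_def)
      qed
      show "H (0, y) = f y" if y: "y \<in> rim z" for y
      proof -
        have "g (\<psi> 0 y) = f0 (\<psi> 0 y)" using in_ends[of 0 y] y by (intro gf0) auto
        then show ?thesis using \<phi>\<psi>[OF y] by (simp add: H_def f0_def \<psi>_def)
      qed
      show "H (1, y) = x0" if y: "y \<in> rim z" for y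
      proof -
        have "g (\<psi> 1 y) = f0 (\<psi> 1 y)" using in_ends[of 1 y] y by (intro gf0) auto
        then show ?thesis by (simp add: H_def f0_def \<psi>_def)
      qed
    qed
  qed
qed

section \<open>Clique complexes\<close>

locale reflexive_graph =
  fixes V :: "'a set" and R :: "'a \<Rightarrow> 'a \<Rightarrow> bool"
  assumes finite_V: "finite V"
    and R_refl: "v \<in> V \<Longrightarrow> R v v"
    and R_sym: "u \<in> V \<Longrightarrow> v \<in> V \<Longrightarrow> R u v \<Longrightarrow> R v u"
begin

text \<open>An open subset of \<open>\<real>\<^sup>V\<close> homotopy equivalent to the realization of the clique complex on
  \<open>W\<close>. Unlike realizations, these sets turn intersections of vertex sets into intersections
  of open sets.\<close>

definition thick :: "'a set \<Rightarrow> ('a \<Rightarrow> real) set" where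
  "thick W = {x. (\<exists>v\<in>V. 0 < x v) \<and> (\<forall>v\<in>V. 0 \<le> x v \<longrightarrow> v \<in> W) \<and>
                 (\<forall>u\<in>V. \<forall>v\<in>V. 0 \<le> x u \<and> 0 \<le> x v \<longrightarrow> R u v)}"

text \<open>The centres need not lie in \<open>W\<close>: intersecting with one more star shrinks
  \<open>W\<close> but leaves the centres unchanged.\<close>

definition star_union :: "'a set \<Rightarrow> 'a set \<Rightarrow> ('a \<Rightarrow> real) set" where
  "star_union W S = (\<Union>s\<in>S. thick (W \<inter> {v. R s v}))"

text \<open>\<open>T\<close> ranges over \<open>V\<close> while the witness is sought in
  \<open>W\<close>; in this form the property survives shrinking \<open>W\<close> to a
  neighbourhood.\<close>

definition dominating :: "nat \<Rightarrow> 'a set \<Rightarrow> bool" where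
  "dominating m W \<longleftrightarrow> W \<subseteq> V \<and> (\<forall>T\<subseteq>V. card T \<le> m \<longrightarrow> (\<exists>w\<in>W. \<forall>t\<in>T. R t w))"

text \<open>Excluding a vertex means a strictly negative coordinate, an open condition, and
  \<open>V\<close> is finite.\<close>

lemma open_thick: "open (thick W)"
proof -
  have *: "open {x::'a \<Rightarrow> real. x v < 0}" "open {x::'a \<Rightarrow> real. 0 < x v}" for v
    by (intro open_Collect_less continuous_intros)+
  have "thick W = (\<Union>v\<in>V. {x. 0 < x v}) \<inter> (\<Inter>v\<in>V. {x. x v < 0} \<union> {x. v \<in> W}) \<inter>
    (\<Inter>u\<in>V. \<Inter>v\<in>V. {x. x u < 0} \<union> {x. x v < 0} \<union> {x. R u v})"
    unfolding thick_def not_less[symmetric] by blast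
  moreover have "open {x::'a \<Rightarrow> real. P}" for P by (cases P) auto
  ultimately show ?thesis
    using * finite_V by (simp add: open_Int open_UN open_INT open_Un)
qed

lemma open_star_union: "open (star_union W S)"
  unfolding star_union_def using open_thick by auto

lemma thick_Int: "thick W \<inter> thick W' = thick (W \<inter> W')"
  by (auto simp: thick_def)

text \<open>An overlap is again a \<open>star_union\<close> with the same centres, so the induction
  stays within one family.\<close>

lemma thick_Int_star_union:
  "thick (W \<inter> {v. R s v}) \<inter> star_union W S = star_union (W \<inter> {v. R s v}) S"
proof -
  have "W \<inter> {v. R s v} \<inter> (W \<inter> {v. R t v}) = W \<inter> {v. R s v} \<inter> {v. R t v}" for t by auto
  then show ?thesis
    by (simp add: star_union_def thick_Int flip: UN_simps)
qed

lemma star_union_insert: "star_union W (insert s S) = thick (W \<inter> {v. R s v}) \<union> star_union W S"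
  by (simp add: star_union_def)

text \<open>A vertex with positive coordinate is adjacent to all vertices with nonnegative
  coordinate, so its star contains the point.\<close>

lemma star_union_self:
  assumes "W \<subseteq> V"
  shows "star_union W W = thick W"
proof
  show "star_union W W \<subseteq> thick W" by (auto simp: star_union_def thick_def)
  show "thick W \<subseteq> star_union W W"
  proof
    fix x assume x: "x \<in> thick W"
    then obtain v where v: "v \<in> V" "0 < x v" by (auto simp: thick_def)
    then have "v \<in> W" "x \<in> thick (W \<inter> {u. R v u})" using x by (auto simp: thick_def)
    then show "x \<in> star_union W W" by (auto simp: star_union_def)
  qed
qed

lemma dominating_mono: "dominating m W \<Longrightarrow> l \<le> m \<Longrightarrow> dominating l W"
  unfolding dominating_def by (meson le_trans)

text \<open>A common neighbour of \<open>insert s T\<close> lies in the neighbourhood of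
  \<open>s\<close>; the place taken by \<open>s\<close> is the cost.\<close>

lemma dominating_Int:
  assumes "dominating (Suc m) W" "s \<in> V"
  shows "dominating m (W \<inter> {v. R s v})"
  unfolding dominating_def
proof (intro conjI allI impI)
  fix T assume "T \<subseteq> V" "card T \<le> m"
  then have "insert s T \<subseteq> V" "card (insert s T) \<le> Suc m"
    using assms(2) card_insert_le_m1[of "Suc m" T s] by auto
  then obtain w where "w \<in> W" "\<forall>t\<in>insert s T. R t w"
    using assms(1) unfolding dominating_def by blast
  then show "\<exists>w\<in>W \<inter> {v. R s v}. \<forall>t\<in>T. R t w" by auto
qed (use assms in \<open>auto simp: dominating_def\<close>)

text \<open>First the coordinate of the apex is moved to \<open>1\<close>, then all other coordinates to \<open>-1\<close>.\<close>

lemma cell_connected_thick_cone: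
  assumes W: "W \<subseteq> V" and s: "s \<in> W" and apex: "\<And>v. v \<in> W \<Longrightarrow> R s v"
  shows "cell_connected q (thick W)"
  unfolding cell_connected_def extends_over_def
proof (intro allI impI, elim conjE)
  fix c :: "nat \<Rightarrow> int" and f :: "(nat \<Rightarrow> real) \<Rightarrow> 'a \<Rightarrow> real"
  assume fin: "finite (axes c)" and contf: "continuous_on (rim c) f" and fim: "f ` rim c \<subseteq> thick W"
  define h where "h a b y = (\<lambda>v. if v = s then (1 - a) * y s + a else (1 - b) * y v - b)"
    for a b :: real and y :: "'a \<Rightarrow> real"
  define y0 where "y0 = (\<lambda>v. if v = s then 1 else - 1 :: real)"
  have sV: "s \<in> V" using W s by auto
  have y0: "y0 \<in> thick W" using s sV R_refl by (auto simp: thick_def y0_def split: if_splits)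
  \<comment> \<open>The other coordinates drop only after the apex has reached 1, so some coordinate
    stays positive throughout. Only \<open>s\<close> can become nonnegative anew, and it is adjacent
    to all of \<open>W\<close>.\<close>
  have h: "h a b y \<in> thick W"
    if y: "y \<in> thick W" and ab: "a \<in> {0..1}" "b \<in> {0..1}" "b = 0 \<or> a = 1" for a b y
  proof -
    have neg: "0 \<le> y v" if "0 \<le> h a b y v" "v \<noteq> s" for v
    proof (rule ccontr)
      assume "\<not> 0 \<le> y v"
      then have yv: "y v < 0" by simp
      show False
      proof (cases "b = 1")
        case True then show False using that by (simp add: h_def)
      next
        case False
        then have "(1 - b) * y v < 0" using yv ab by (intro mult_pos_neg) auto
        then show False using that ab by (simp add: h_def)
      qed
    qed
    have mem: "v \<in> W" if "v \<in> V" "0 \<le> h a b y v" for v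
      using neg[of v] that y s by (cases "v = s") (auto simp: thick_def)
    have "R u v" if uv: "u \<in> V" "v \<in> V" "0 \<le> h a b y u" "0 \<le> h a b y v" for u v
    proof (cases "u = s \<or> v = s")
      case True
      then show ?thesis using apex mem uv R_sym sV by blast
    next
      case False
      then show ?thesis using neg uv y by (auto simp: thick_def)
    qed
    moreover have "\<exists>v\<in>V. 0 < h a b y v"
    proof (cases "a = 1")
      case True then show ?thesis using sV by (intro bexI[of _ s]) (auto simp: h_def)
    next
      case False
      then have b0: "b = 0" using ab by auto
      obtain v where v: "v \<in> V" "0 < y v" using y by (auto simp: thick_def)
      have "0 < h a b y v"
      proof (cases "v = s")
        case True
        have "0 < (1 - a) * y s" using False ab v True by (intro mult_pos_pos) auto
        then show ?thesis using True ab by (simp add: h_def)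
      qed (use v b0 in \<open>simp add: h_def\<close>)
      then show ?thesis using v by auto
    qed
    ultimately show ?thesis using mem by (auto simp: thick_def)
  qed
  define H where "H = (\<lambda>p. h (min 1 (2 * fst p)) (max 0 (2 * fst p - 1)) (f (snd p)))"
  show "\<exists>g. continuous_on (cell c) g \<and> g ` cell c \<subseteq> thick W \<and> (\<forall>x\<in>rim c. g x = f x)"
  proof (rule extension_of_nullhomotopic[OF fin y0])
    have f': "continuous_on ({0..1::real} \<times> rim c) (\<lambda>p. f (snd p))"
      by (rule continuous_on_compose2[OF contf continuous_on_snd[OF continuous_on_id]]) auto
    have f'': "continuous_on ({0..1::real} \<times> rim c) (\<lambda>p. f (snd p) v)" for v
      by (rule continuous_on_product_then_coordinatewise[OF f'])
    have "continuous_on ({0..1::real} \<times> rim c) (\<lambda>p. H p v)" for v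
      unfolding H_def h_def
      by (cases "v = s")
        (auto intro!: continuous_on_mult continuous_on_diff continuous_on_add continuous_on_min
          continuous_on_max continuous_on_const continuous_on_fst continuous_on_id f'')
    then show "continuous_on ({0..1} \<times> rim c) H"
      by (rule continuous_on_coordinatewise_then_product)
    show "H ` ({0..1} \<times> rim c) \<subseteq> thick W"
    proof clarify
      fix t :: real and x assume "t \<in> {0..1}" "x \<in> rim c"
      then show "H (t, x) \<in> thick W"
        unfolding H_def using fim by (intro h) (auto simp: min_def max_def)
    qed
    show "H (0, x) = f x" if "x \<in> rim c" for x by (auto simp: H_def h_def)
    show "H (1, x) = y0" if "x \<in> rim c" for x by (auto simp: H_def h_def y0_def)
  qed
qed

text \<open>Attaches the stars one at a time by gluing. The hypothesis on overlaps covers every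
  nonempty \<open>T\<close> because a new star meets whatever union has been built so far.\<close>

lemma cell_connected_star_union_induct:
  assumes fin: "finite S" and ne: "S \<noteq> {}"
    and piece: "\<And>s. s \<in> S \<Longrightarrow> cell_connected (Suc q) (thick (W \<inter> {v. R s v}))"
    and overlap: "\<And>s T. \<lbrakk>s \<in> S; T \<subseteq> S; T \<noteq> {}\<rbrakk> \<Longrightarrow> cell_connected q (star_union (W \<inter> {v. R s v}) T)"
  shows "cell_connected (Suc q) (star_union W S)"
  using fin ne piece overlap
proof (induction rule: finite_ne_induct)
  case (singleton s)
  then show ?case by (simp add: star_union_def)
next
  case (insert s S)
  have "cell_connected (Suc q) (thick (W \<inter> {v. R s v}) \<union> star_union W S)"
  proof (rule cell_connected_Un[OF open_thick _ open_star_union])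
    show "cell_connected q (thick (W \<inter> {v. R s v}) \<inter> star_union W S)"
      unfolding thick_Int_star_union using insert.prems(2)[of s S] insert.hyps(2) by auto
    show "cell_connected (Suc q) (star_union W S)"
    proof (rule insert.IH)
      show "cell_connected q (star_union (W \<inter> {v. R t v}) T)"
        if "t \<in> S" "T \<subseteq> S" "T \<noteq> {}" for t T
        using insert.prems(2)[of t T] that by blast
    qed (use insert.prems(1) in simp)
  qed (use insert.prems in auto)
  then show ?case by (simp add: star_union_insert)
qed

text \<open>With centres in \<open>W\<close> itself the pieces are cones, so only the overlaps
  remain to be controlled. Domination of the empty set provides a vertex of
  \<open>W\<close>.\<close>

lemma cell_connected_thick_if_overlaps:
  assumes overlap: "\<And>s T. \<lbrakk>s \<in> V; T \<subseteq> V; T \<noteq> {}\<rbrakk> \<Longrightarrow> cell_connected k (star_union (W \<inter> {v. R s v}) T)"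
    and W: "dominating m W"
  shows "cell_connected (Suc k) (thick W)"
proof -
  have WV: "W \<subseteq> V" using W by (simp add: dominating_def)
  have ne: "W \<noteq> {}" using W unfolding dominating_def by (metis card.empty empty_iff empty_subsetI zero_le)
  have "cell_connected (Suc k) (star_union W W)"
  proof (rule cell_connected_star_union_induct[OF finite_subset[OF WV finite_V] ne])
    fix s assume "s \<in> W"
    then show "cell_connected (Suc k) (thick (W \<inter> {v. R s v}))"
      using WV R_refl by (intro cell_connected_thick_cone[of _ s]) auto
  next
    fix s T assume "s \<in> W" "T \<subseteq> W" "T \<noteq> {}"
    then show "cell_connected k (star_union (W \<inter> {v. R s v}) T)"
      using WV by (intro overlap) auto
  qed
  then show ?thesis by (simp add: star_union_self[OF WV])
qed

text \<open>Each intersection with a star costs one vertex of domination. Passing from \<open>thick W\<close> to its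
  overlaps and from there to their pieces intersects twice and lowers the required connectivity
  by one, which is why \<open>2 k\<close> vertices suffice.\<close>

lemma cell_connected_dominating:
  "(dominating (2 * k) W \<longrightarrow> cell_connected (Suc k) (thick W)) \<and>
   (dominating (2 * k + 1) W \<and> S \<subseteq> V \<and> S \<noteq> {} \<longrightarrow> cell_connected (Suc k) (star_union W S))"
proof (induction k arbitrary: W S)
  case IH: (Suc k)
  \<comment> \<open>One intersection turns domination \<open>2 * k + 2\<close> into
    \<open>2 * k + 1\<close>, which is what the second half of the induction hypothesis asks
    for.\<close>
  have overlap: "cell_connected (Suc k) (star_union (W \<inter> {v. R s v}) T)"
    if "dominating (2 * Suc k) W" "s \<in> V" "T \<subseteq> V" "T \<noteq> {}" for W s T
    using IH dominating_Int[of "2 * k + 1" W s] that by simp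
  have thick: "cell_connected (Suc (Suc k)) (thick W)" if "dominating (2 * Suc k) W" for W
    using cell_connected_thick_if_overlaps[OF overlap] that by blast
  \<comment> \<open>Centres may lie outside \<open>W\<close>, so the pieces need not be cones; the
    additional vertex of domination lets \<open>thick\<close> handle them.\<close>
  have "cell_connected (Suc (Suc k)) (star_union W S)"
    if W: "dominating (2 * Suc k + 1) W" and S: "S \<subseteq> V" "S \<noteq> {}"
  proof (rule cell_connected_star_union_induct[OF finite_subset[OF S(1) finite_V] S(2)])
    fix s assume "s \<in> S"
    then show "cell_connected (Suc (Suc k)) (thick (W \<inter> {v. R s v}))"
      using W S by (intro thick dominating_Int) auto
  next
    fix s T assume "s \<in> S" "T \<subseteq> S" "T \<noteq> {}"
    moreover have "dominating (2 * Suc k) W" by (rule dominating_mono[OF W]) simp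
    ultimately show "cell_connected (Suc k) (star_union (W \<inter> {v. R s v}) T)"
      using S by (intro overlap) auto
  qed
  then show ?case using thick by blast
next
  case 0
  have thick: "cell_connected (Suc 0) (thick W)" if "dominating (2 * 0) W" for W
    using cell_connected_thick_if_overlaps[OF cell_connected_0] that by blast
  have "cell_connected (Suc 0) (star_union W S)"
    if W: "dominating (2 * 0 + 1) W" and S: "S \<subseteq> V" "S \<noteq> {}"
    using W S by (intro cell_connected_star_union_induct[OF finite_subset[OF S(1) finite_V] S(2)]
        thick dominating_Int cell_connected_0) auto
  then show ?case using thick by blast
qed

end

section \<open>Homotopy groups\<close>

text \<open>First deform the map to one that factors through \<open>Z\<close>, then contract it inside the image of
  a filling in \<open>Z\<close>.\<close>

lemma cell_connected_homotopy_retract: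
  fixes Y :: "'b::topological_space set" and Z :: "'c::topological_space set"
  assumes Z: "cell_connected q Z"
    and a: "continuous_on Y a" "a ` Y \<subseteq> Z" and b: "continuous_on Z b" "b ` Z \<subseteq> Y"
    and contL: "continuous_on ({0..1::real} \<times> Y) L" and LY: "L ` ({0..1} \<times> Y) \<subseteq> Y"
    and L0: "\<And>y. y \<in> Y \<Longrightarrow> L (0, y) = y" and L1: "\<And>y. y \<in> Y \<Longrightarrow> L (1, y) = b (a y)"
  shows "cell_connected q Y"
  unfolding cell_connected_def extends_over_def
proof (intro allI impI, elim conjE)
  fix c :: "nat \<Rightarrow> int" and f :: "(nat \<Rightarrow> real) \<Rightarrow> 'b"
  assume fin: "finite (axes c)" and card: "card (axes c) < q"
    and contf: "continuous_on (rim c) f" and fim: "f ` rim c \<subseteq> Y"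
  have 1: "continuous_on (rim c) (\<lambda>x. a (f x))"
    by (rule continuous_on_compose2[OF a(1) contf fim])
  have 2: "(\<lambda>x. a (f x)) ` rim c \<subseteq> Z" using fim a(2) by auto
  have "extends_over c Z" using Z fin card by (simp add: cell_connected_def)
  then obtain g where g: "continuous_on (cell c) g" "g ` cell c \<subseteq> Z"
    and gf: "\<And>x. x \<in> rim c \<Longrightarrow> g x = a (f x)"
    using extends_overD[OF _ 1 2] by auto
  define m where "m = (\<lambda>i. of_int (c i) / 2 :: real)"
  \<comment> \<open>The segment from the point itself at time 1/2 to the centre \<open>m\<close> at
    time 1; it stays in the cell by convexity.\<close>
  define l where "l p = (\<lambda>i. (2 - 2 * fst p) * snd p i + (2 * fst p - 1) * m i)"
    for p :: "real \<times> (nat \<Rightarrow> real)"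
  define A where "A = {0..1/2::real} \<times> rim c"
  define B where "B = {1/2..1::real} \<times> rim c"
  have m: "m \<in> cell c" by (rule cellI) (auto simp: m_def)
  have l: "l p \<in> cell c" if p: "p \<in> B" for p
  proof -
    obtain t x where tx: "p = (t, x)" "1/2 \<le> t" "t \<le> 1" "x \<in> cell c"
      using p rim_subset_cell[of c] by (cases p) (auto simp: B_def)
    have e: "2 * l p i - of_int (c i) = (2 - 2 * t) * (2 * x i - of_int (c i))" for i
      by (simp add: l_def m_def tx(1) field_simps)
    show ?thesis
    proof (rule cellI)
      fix i assume "odd (c i)"
      then have "\<bar>2 * x i - of_int (c i)\<bar> \<le> 1" by (rule cell_odd[OF tx(4)])
      then have "\<bar>2 - 2 * t\<bar> * \<bar>2 * x i - of_int (c i)\<bar> \<le> 1 * 1"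
        using tx by (intro mult_mono) auto
      then show "\<bar>2 * l p i - of_int (c i)\<bar> \<le> 1" by (simp add: e abs_mult)
    next
      fix i assume "even (c i)"
      then show "2 * l p i = of_int (c i)" using e[of i] cell_even[OF tx(4), of i] by simp
    qed
  qed
  define H where "H p = (if fst p \<le> 1/2 then L (2 * fst p, f (snd p)) else b (g (l p)))" for p
  have gZ: "g x \<in> Z" if "x \<in> cell c" for x using g that by auto
  have half: "L (2 * fst p, f (snd p)) = b (g (l p))" if "p \<in> A \<union> B" "fst p = 1/2" for p
  proof -
    have x: "snd p \<in> rim c" using that by (auto simp: A_def B_def)
    have "l p = snd p" unfolding l_def that(2) by simp
    moreover have "2 * fst p = 1" using that(2) by simp
    moreover have "f (snd p) \<in> Y" using x fim by auto
    ultimately show ?thesis using L1[of "f (snd p)"] gf[OF x] by simp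
  qed
  show "\<exists>g. continuous_on (cell c) g \<and> g ` cell c \<subseteq> Y \<and> (\<forall>x\<in>rim c. g x = f x)"
  proof (rule extension_of_nullhomotopic[OF fin])
    show "b (g m) \<in> Y" using b(2) gZ[OF m] by auto
    have contA: "continuous_on A (\<lambda>p. L (2 * fst p, f (snd p)))"
    proof (rule continuous_on_compose2[OF contL])
      have "continuous_on A (\<lambda>p. f (snd p))"
        by (rule continuous_on_compose2[OF contf continuous_on_snd[OF continuous_on_id]])
          (auto simp: A_def)
      then show "continuous_on A (\<lambda>p. (2 * fst p, f (snd p)))"
        by (intro continuous_on_Pair continuous_on_mult continuous_on_const continuous_on_fst continuous_on_id)
    qed (use fim in \<open>auto simp: A_def\<close>)
    have contB: "continuous_on B (\<lambda>p. b (g (l p)))"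
    proof -
      have "continuous_on B (\<lambda>p. l p i)" for i
      proof -
        have "continuous_on B (\<lambda>p. snd p i)"
          by (rule continuous_on_product_then_coordinatewise[OF continuous_on_snd[OF continuous_on_id]])
        then show ?thesis
          unfolding l_def
          by (intro continuous_on_mult continuous_on_diff continuous_on_add continuous_on_const
              continuous_on_fst continuous_on_id)
      qed
      then have "continuous_on B l" by (rule continuous_on_coordinatewise_then_product)
      then have "continuous_on B (\<lambda>p. g (l p))"
        by (rule continuous_on_compose2[OF g(1)]) (use l in auto)
      then show ?thesis
        by (rule continuous_on_compose2[OF b(1)]) (use l gZ in auto)
    qed
    have "closed A" "closed B"
      unfolding A_def B_def using closed_rim[OF fin] by (auto intro: closed_Times)
    then have "continuous_on (A \<union> B) H"
      unfolding H_def using contA contB half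
      by (intro continuous_on_If) (auto simp: A_def B_def)
    moreover have "A \<union> B = {0..1} \<times> rim c" by (auto simp: A_def B_def)
    ultimately show "continuous_on ({0..1} \<times> rim c) H" by simp
    show "H ` ({0..1} \<times> rim c) \<subseteq> Y"
    proof clarify
      fix t :: real and x assume t: "t \<in> {0..1}" and x: "x \<in> rim c"
      show "H (t, x) \<in> Y"
      proof (cases "t \<le> 1/2")
        case True
        then have "(2 * t, f x) \<in> {0..1} \<times> Y" using t x fim by auto
        then have "L (2 * t, f x) \<in> Y" using LY by blast
        then show ?thesis using True by (simp add: H_def)
      next
        case False
        then have "l (t, x) \<in> cell c" using t x by (intro l) (auto simp: B_def)
        then show ?thesis using False gZ b(2) by (auto simp: H_def)
      qed
    qed
    show "H (0, x) = f x" if "x \<in> rim c" for x using that L0 fim by (auto simp: H_def)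
    show "H (1, x) = b (g m)" if "x \<in> rim c" for x by (simp add: H_def l_def)
  qed
qed

section \<open>From rims of cubes to round spheres\<close>

definition sphere_set :: "nat \<Rightarrow> (nat \<Rightarrow> real) set" where
  "sphere_set i = {x. (\<Sum>j\<le>i. x j ^ 2) = 1 \<and> (\<forall>j>i. x j = 0)}"

lemma nsphere_eq: "nsphere i = top_of_set (sphere_set i)"
  by (simp add: nsphere sphere_set_def euclidean_product_topology)

lemma sphere_base_in: "sphere_base \<in> sphere_set i"
  by (auto simp: sphere_base_def sphere_set_def power2_eq_square if_distrib [where f = "\<lambda>x. x * _"] cong: if_cong)

text \<open>The sphere is the rim of a cube up to radial projection, and filling the cube
  gives a null-homotopy along straight lines to the base point, which fixes the base point.\<close>

lemma based_map_nullhomotopic: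
  fixes Y :: "'b::topological_space set"
  assumes Y: "cell_connected (i + 2) Y"
    and contf: "continuous_on (sphere_set i) f" and fim: "f ` sphere_set i \<subseteq> Y"
    and base: "f sphere_base = x"
  shows "homotopic_with (\<lambda>h. h sphere_base = x) (nsphere i) (top_of_set Y) f (\<lambda>_. x)"
proof -
  \<comment> \<open>A unit cube of dimension \<open>i + 1\<close>, the largest dimension covered by
    \<open>cell_connected (i + 2)\<close>; its centre has coordinates 1/2 along the axes.\<close>
  define c :: "nat \<Rightarrow> int" where "c j = (if j \<le> i then 1 else 0)" for j
  have ax: "axes c = {..i}" by (auto simp: axes_def c_def)
  define n where "n y = sqrt (\<Sum>j\<le>i. (2 * y j - 1)^2)" for y :: "nat \<Rightarrow> real"
  define \<sigma> where "\<sigma> y = (\<lambda>j. if j \<le> i then (2 * y j - 1) / n y else 0)" for y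
  define M where "M s = Max ((\<lambda>j. \<bar>s j\<bar>) ` {..i})" for s :: "nat \<Rightarrow> real"
  define \<rho> where "\<rho> s = (\<lambda>j. if j \<le> i then (1 + s j / M s) / 2 else 0)" for s
  have n_pos: "0 < n y" if y: "y \<in> rim c" for y
  proof -
    obtain j where j: "j \<le> i" "\<bar>2 * y j - 1\<bar> = 1"
      using y by (auto simp: rim_def c_def split: if_splits)
    then have "0 < (2 * y j - 1)^2" by auto
    also have "\<dots> \<le> (\<Sum>j\<le>i. (2 * y j - 1)^2)" using j(1) by (intro member_le_sum) auto
    finally show ?thesis by (simp add: n_def)
  qed
  have \<sigma>: "\<sigma> y \<in> sphere_set i" if "y \<in> rim c" for y
  proof -
    have "(\<Sum>j\<le>i. (\<sigma> y j)^2) = (\<Sum>j\<le>i. (2 * y j - 1)^2 / (n y)^2)"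
      by (intro sum.cong) (auto simp: \<sigma>_def power_divide)
    also have "\<dots> = (\<Sum>j\<le>i. (2 * y j - 1)^2) / (n y)^2" by (simp add: sum_divide_distrib)
    also have "(n y)^2 = (\<Sum>j\<le>i. (2 * y j - 1)^2)" by (simp add: n_def sum_nonneg)
    finally have "(\<Sum>j\<le>i. (\<sigma> y j)^2) = 1" using n_pos[OF that] by (auto simp: n_def)
    then show ?thesis by (auto simp: sphere_set_def \<sigma>_def)
  qed
  have M_ge: "\<bar>s j\<bar> \<le> M s" if "j \<le> i" for s j
    unfolding M_def using that by (intro Max_ge) auto
  have M_att: "\<exists>j\<le>i. M s = \<bar>s j\<bar>" for s
  proof -
    have "M s \<in> (\<lambda>j. \<bar>s j\<bar>) ` {..i}" unfolding M_def by (intro Max_in) auto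
    then show ?thesis by auto
  qed
  have M_pos: "0 < M s" if s: "s \<in> sphere_set i" for s
  proof (rule ccontr)
    assume "\<not> 0 < M s"
    then have "s j = 0" if "j \<le> i" for j using M_ge[OF that, of s] by auto
    then have "(\<Sum>j\<le>i. s j ^ 2) = 0" by simp
    then show False using s by (simp add: sphere_set_def)
  qed
  have \<rho>2: "2 * \<rho> s j - 1 = s j / M s" if "j \<le> i" for s j
  proof -
    have "2 * ((1 + u) / 2) - 1 = u" for u :: real by (simp add: field_simps)
    then show ?thesis by (simp only: \<rho>_def that if_True)
  qed
  have \<rho>: "\<rho> s \<in> rim c" if s: "s \<in> sphere_set i" for s
  proof -
    have "\<rho> s \<in> cell c"
    proof (rule cellI)
      fix j assume "odd (c j)"
      then have j: "j \<le> i" by (auto simp: c_def split: if_splits)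
      then show "\<bar>2 * \<rho> s j - of_int (c j)\<bar> \<le> 1"
        using \<rho>2[OF j] M_ge[OF j, of s] M_pos[OF s] by (simp add: c_def)
    next
      fix j assume "even (c j)"
      then show "2 * \<rho> s j = of_int (c j)" by (auto simp: c_def \<rho>_def split: if_splits)
    qed
    moreover obtain j where j: "j \<le> i" "M s = \<bar>s j\<bar>" using M_att by blast
    then have "odd (c j)" "\<bar>2 * \<rho> s j - of_int (c j)\<bar> = 1"
      using \<rho>2[OF j(1), of s] M_pos[OF s] by (auto simp: c_def)
    ultimately show ?thesis by (auto simp: rim_def)
  qed
  \<comment> \<open>This makes the filling \<open>g\<close>, pulled back along \<rho>, agree with
    \<open>f\<close> on the sphere.\<close>
  have \<sigma>\<rho>: "\<sigma> (\<rho> s) = s" if s: "s \<in> sphere_set i" for s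
  proof
    fix j
    have "(\<Sum>j\<le>i. (2 * \<rho> s j - 1)^2) = (\<Sum>j\<le>i. (s j)^2 / (M s)^2)"
      by (intro sum.cong) (auto simp: \<rho>2 power_divide)
    also have "\<dots> = (\<Sum>j\<le>i. (s j)^2) / (M s)^2" by (simp add: sum_divide_distrib)
    also have "\<dots> = 1 / (M s)^2" using s by (simp add: sphere_set_def)
    finally have n: "n (\<rho> s) = 1 / M s" using M_pos[OF s] by (simp add: n_def real_sqrt_divide)
    show "\<sigma> (\<rho> s) j = s j"
    proof (cases "j \<le> i")
      case True
      then show ?thesis using \<rho>2[OF True, of s] n M_pos[OF s] by (simp add: \<sigma>_def)
    next
      case False
      then show ?thesis using s by (simp add: \<sigma>_def sphere_set_def)
    qed
  qed
  have "continuous_on (rim c) n"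
    unfolding n_def by (intro continuous_intros)
  moreover have "\<forall>y\<in>rim c. n y \<noteq> 0" using n_pos by (metis less_irrefl)
  ultimately have "continuous_on (rim c) (\<lambda>y. (2 * y j - 1) / n y)" for j
    by (auto intro!: continuous_on_divide[of _ _ n] continuous_on_diff continuous_on_mult
        continuous_on_const continuous_on_coordinate)
  then have "continuous_on (rim c) (\<lambda>y. \<sigma> y j)" for j
    unfolding \<sigma>_def by (cases "j \<le> i") auto
  then have "continuous_on (rim c) \<sigma>" by (rule continuous_on_coordinatewise_then_product)
  then have 1: "continuous_on (rim c) (\<lambda>y. f (\<sigma> y))"
    by (rule continuous_on_compose2[OF contf]) (use \<sigma> in auto)
  have 2: "(\<lambda>y. f (\<sigma> y)) ` rim c \<subseteq> Y" using \<sigma> fim by auto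
  have "extends_over c Y" using Y ax by (simp add: cell_connected_def)
  then obtain g where g: "continuous_on (cell c) g" "g ` cell c \<subseteq> Y"
    and gf: "\<And>y. y \<in> rim c \<Longrightarrow> g y = f (\<sigma> y)"
    using extends_overD[OF _ 1 2] by auto
  have contM: "continuous_on (sphere_set i) M"
    unfolding M_def by (intro continuous_on_Max continuous_intros) auto
  have "\<forall>s\<in>sphere_set i. M s \<noteq> 0" using M_pos by (metis less_irrefl)
  then have "continuous_on (sphere_set i) (\<lambda>s. (1 + s j / M s) / 2)" for j
    using contM
    by (intro continuous_on_divide[of _ _ "\<lambda>_. 2"] continuous_on_divide[of _ _ M] continuous_on_add
        continuous_on_const continuous_on_coordinate) auto
  then have "continuous_on (sphere_set i) (\<lambda>s. \<rho> s j)" for j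
    unfolding \<rho>_def by (cases "j \<le> i") auto
  then have cont\<rho>: "continuous_on (sphere_set i) \<rho>" by (rule continuous_on_coordinatewise_then_product)
  define l where "l p = (\<lambda>j. (1 - fst p) * \<rho> (snd p) j + fst p * \<rho> sphere_base j)"
    for p :: "real \<times> (nat \<Rightarrow> real)"
  have l: "l (t, s) \<in> cell c" if t: "t \<in> {0..1}" and s: "s \<in> sphere_set i" for t s
  proof -
    have 1: "\<rho> s \<in> cell c" "\<rho> sphere_base \<in> cell c"
      using \<rho> s sphere_base_in rim_subset_cell by blast+
    show ?thesis
    proof (rule cellI)
      fix j assume o: "odd (c j)"
      have "2 * l (t, s) j - of_int (c j) =
          (1 - t) * (2 * \<rho> s j - of_int (c j)) + t * (2 * \<rho> sphere_base j - of_int (c j))"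
        by (simp add: l_def algebra_simps)
      also have "\<bar>\<dots>\<bar> \<le> \<bar>1 - t\<bar> * \<bar>2 * \<rho> s j - of_int (c j)\<bar> + \<bar>t\<bar> * \<bar>2 * \<rho> sphere_base j - of_int (c j)\<bar>"
        by (metis abs_mult abs_triangle_ineq)
      also have "\<dots> \<le> \<bar>1 - t\<bar> * 1 + \<bar>t\<bar> * 1"
        using cell_odd[OF 1(1) o] cell_odd[OF 1(2) o] by (intro add_mono mult_left_mono) auto
      also have "\<dots> = 1" using t by simp
      finally show "\<bar>2 * l (t, s) j - of_int (c j)\<bar> \<le> 1" .
    next
      fix j assume e: "even (c j)"
      then have "\<not> j \<le> i" by (auto simp: c_def)
      then show "2 * l (t, s) j = of_int (c j)" by (simp add: l_def \<rho>_def c_def)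
    qed
  qed
  have "continuous_on ({0..1} \<times> sphere_set i) (\<lambda>p. l p j)" for j
  proof -
    have "continuous_on ({0..1::real} \<times> sphere_set i) (\<lambda>p. \<rho> (snd p))"
      by (rule continuous_on_compose2[OF cont\<rho> continuous_on_snd[OF continuous_on_id]]) auto
    then have "continuous_on ({0..1::real} \<times> sphere_set i) (\<lambda>p. \<rho> (snd p) j)"
      by (rule continuous_on_product_then_coordinatewise)
    then show ?thesis
      unfolding l_def
      by (intro continuous_on_mult continuous_on_diff continuous_on_add continuous_on_const
          continuous_on_fst continuous_on_id)
  qed
  then have "continuous_on ({0..1} \<times> sphere_set i) l"
    by (rule continuous_on_coordinatewise_then_product)
  then have contgl: "continuous_on ({0..1} \<times> sphere_set i) (\<lambda>p. g (l p))"
    by (rule continuous_on_compose2[OF g(1)]) (use l in auto)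
  have g\<rho>: "g (\<rho> s) = f s" if "s \<in> sphere_set i" for s
    using gf[OF \<rho>[OF that]] \<sigma>\<rho>[OF that] by simp
  have l_base: "l (t, sphere_base) = \<rho> sphere_base" for t
    by (auto simp: l_def algebra_simps)
  have l1: "l (1, s) = \<rho> sphere_base" and l0: "l (0, s) = \<rho> s" for s
    by (auto simp: l_def)
  have gb: "g (\<rho> sphere_base) = x" using g\<rho>[OF sphere_base_in] base by simp
  have im: "(\<lambda>p. g (l p)) ` ({0..1} \<times> sphere_set i) \<subseteq> Y" using l g(2) by auto
  have "continuous_map (prod_topology (top_of_set {0..1}) (top_of_set (sphere_set i))) (top_of_set Y) (\<lambda>p. g (l p))"
    using contgl im by (simp add: image_subset_iff_funcset)
  then have "\<exists>h. continuous_map (prod_topology (top_of_set {0..1::real}) (top_of_set (sphere_set i))) (top_of_set Y) h \<and>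
      (\<forall>s\<in>sphere_set i. h (0, s) = f s) \<and> (\<forall>s\<in>sphere_set i. h (1, s) = x) \<and>
      (\<forall>t\<in>{0..1}. h (t, sphere_base) = x)"
    by (intro exI[of _ "\<lambda>p. g (l p)"]) (simp add: l0 l1 l_base g\<rho> gb)
  then show ?thesis
    unfolding nsphere_eq by (subst homotopic_with) (auto simp: sphere_base_in)
qed

text \<open>Every based map is homotopic to the constant one, so the whole set \<open>F\<close> of
  based maps is the only class; the constant map shows that there is one.\<close>

lemma homotopy_group_set_trivial:
  fixes Y :: "'b::topological_space set"
  assumes Y: "cell_connected (i + 2) Y" and x: "x \<in> Y"
  shows "is_singleton (homotopy_group_set i (top_of_set Y) x)"
proof -
  define P where "P = (\<lambda>h. h sphere_base = x)"
  define F where "F = {f. continuous_map (nsphere i) (top_of_set Y) f \<and> P f}"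
  define r where "r = {(f, g). homotopic_with P (nsphere i) (top_of_set Y) f g}"
  have null: "homotopic_with P (nsphere i) (top_of_set Y) f (\<lambda>_. x)" if "f \<in> F" for f
    using that based_map_nullhomotopic[OF Y, of f x] unfolding P_def F_def nsphere_eq by auto
  have cls: "r `` {f} = F" if f: "f \<in> F" for f
  proof
    show "r `` {f} \<subseteq> F"
      using homotopic_with_imp_continuous_maps homotopic_with_imp_property
      unfolding r_def F_def by blast
    show "F \<subseteq> r `` {f}"
      using null[OF f] null homotopic_with_trans homotopic_with_sym unfolding r_def by blast
  qed
  have "(\<lambda>_. x) \<in> F" using x by (simp add: F_def P_def)
  then have "F // r = {F}" using cls by (auto simp: quotient_def)
  then show ?thesis
    unfolding homotopy_group_set_def F_def r_def P_def by simp
qed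

section \<open>The hypercube\<close>

context reflexive_graph
begin

text \<open>The realization of the clique complex, with the condition on supports spelled out as
  pairwise adjacency for comparison with \<open>thick V\<close>.\<close>

definition clique_points :: "('a \<Rightarrow> real) set" where
  "clique_points = {x. (\<forall>v. 0 \<le> x v) \<and> (\<forall>v. v \<notin> V \<longrightarrow> x v = 0) \<and> (\<Sum>v\<in>V. x v) = 1 \<and>
                       (\<forall>u\<in>V. \<forall>v\<in>V. x u \<noteq> 0 \<and> x v \<noteq> 0 \<longrightarrow> R u v)}"

text \<open>Lowering all coordinates by a threshold leads into \<open>thick V\<close>; taking
  positive parts and normalizing leads back. The round trip never enlarges a support, so it is
  joined to the identity by straight lines.\<close>

lemma cell_connected_clique_points:
  assumes ne: "V \<noteq> {}" and thick: "cell_connected q (thick V)"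
  shows "cell_connected q clique_points"
proof -
  \<comment> \<open>Half the average coordinate: some coordinate exceeds it, and every vanishing
    coordinate becomes negative.\<close>
  define c where "c = 1 / (2 * real (card V))"
  have cV: "0 < real (card V)" using ne finite_V by (simp add: card_gt_0_iff)
  have c0: "0 < c" using cV by (simp add: c_def)
  define a where "a x = (\<lambda>v. x v - c)" for x :: "'a \<Rightarrow> real"
  define m where "m y = (\<Sum>v\<in>V. max (y v) 0)" for y :: "'a \<Rightarrow> real"
  define b where "b y = (\<lambda>v. if v \<in> V then max (y v) 0 / m y else 0)" for y
  define L where "L p = (\<lambda>v. (1 - fst p) * snd p v + fst p * b (a (snd p)) v)"
    for p :: "real \<times> ('a \<Rightarrow> real)"
  have a: "a x \<in> thick V" if x: "x \<in> clique_points" for x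
  proof -
    have "\<exists>v\<in>V. c < x v"
    proof (rule ccontr)
      assume "\<not> (\<exists>v\<in>V. c < x v)"
      then have "(\<Sum>v\<in>V. x v) \<le> (\<Sum>v\<in>V. c)" by (intro sum_mono) auto
      also have "\<dots> = 1 / 2" using cV by (simp add: c_def)
      finally show False using x by (simp add: clique_points_def)
    qed
    moreover have "R u v" if "u \<in> V" "v \<in> V" "c \<le> x u" "c \<le> x v" for u v
    proof -
      have "x u \<noteq> 0" "x v \<noteq> 0" using that c0 by auto
      then show ?thesis using x that by (simp add: clique_points_def)
    qed
    ultimately show ?thesis by (auto simp: thick_def a_def)
  qed
  have m_pos: "0 < m y" if y: "y \<in> thick V" for y
  proof -
    obtain v where v: "v \<in> V" "0 < y v" using y by (auto simp: thick_def)
    then have "0 < max (y v) 0" by simp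
    also have "\<dots> \<le> m y" unfolding m_def using v finite_V by (intro member_le_sum) auto
    finally show ?thesis .
  qed
  have b_nz: "0 < y v \<and> v \<in> V" if "b y v \<noteq> 0" for y v
    using that by (auto simp: b_def max_def split: if_splits)
  have b: "b y \<in> clique_points" if y: "y \<in> thick V" for y
  proof -
    have "(\<Sum>v\<in>V. b y v) = (\<Sum>v\<in>V. max (y v) 0 / m y)" by (intro sum.cong) (auto simp: b_def)
    also have "\<dots> = m y / m y" by (simp flip: sum_divide_distrib m_def)
    also have "\<dots> = 1" using m_pos[OF y] by simp
    finally have "(\<Sum>v\<in>V. b y v) = 1" .
    moreover have "R u v" if uv: "b y u \<noteq> 0" "b y v \<noteq> 0" for u v
      using b_nz[OF uv(1)] b_nz[OF uv(2)] y by (auto simp: thick_def)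
    moreover have "0 \<le> b y v" for v using m_pos[OF y] by (simp add: b_def)
    ultimately show ?thesis by (auto simp: clique_points_def b_def)
  qed
  have conta: "continuous_on S a" for S
    unfolding a_def
    by (rule continuous_on_coordinatewise_then_product) (intro continuous_intros)
  have contm: "continuous_on S m" for S
    unfolding m_def by (intro continuous_intros)
  have contb: "continuous_on (thick V) b"
  proof (rule continuous_on_coordinatewise_then_product)
    fix v
    have "\<forall>y\<in>thick V. m y \<noteq> 0" using m_pos by (metis less_irrefl)
    then have "continuous_on (thick V) (\<lambda>y. max (y v) 0 / m y)"
      by (intro continuous_on_divide[of _ _ m] contm continuous_on_max continuous_on_const
          continuous_on_coordinate) auto
    then show "continuous_on (thick V) (\<lambda>y. b y v)"
      by (cases "v \<in> V") (simp_all add: b_def)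
  qed
  show ?thesis
  proof (rule cell_connected_homotopy_retract[OF thick conta _ contb])
    show "a ` clique_points \<subseteq> thick V" using a by auto
    show "b ` thick V \<subseteq> clique_points" using b by auto
    show "continuous_on ({0..1} \<times> clique_points) L"
    proof (rule continuous_on_coordinatewise_then_product)
      fix v
      have snd: "continuous_on ({0..1::real} \<times> clique_points) snd"
        by (rule continuous_on_snd[OF continuous_on_id])
      have "continuous_on ({0..1::real} \<times> clique_points) (\<lambda>p. a (snd p))"
        by (rule continuous_on_compose2[OF conta snd]) auto
      then have "continuous_on ({0..1::real} \<times> clique_points) (\<lambda>p. b (a (snd p)))"
        by (rule continuous_on_compose2[OF contb]) (use a in auto)
      then have "continuous_on ({0..1::real} \<times> clique_points) (\<lambda>p. b (a (snd p)) v)"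
        by (rule continuous_on_product_then_coordinatewise)
      then show "continuous_on ({0..1} \<times> clique_points) (\<lambda>p. L p v)"
        unfolding L_def
        by (intro continuous_on_mult continuous_on_diff continuous_on_add continuous_on_const
            continuous_on_fst continuous_on_id continuous_on_product_then_coordinatewise[OF snd])
    qed
    show "L ` ({0..1} \<times> clique_points) \<subseteq> clique_points"
    proof clarify
      fix t :: real and x assume t: "t \<in> {0..1}" and x: "x \<in> clique_points"
      define y where "y = b (a x)"
      have y: "y \<in> clique_points" unfolding y_def using b a x by blast
      have Lv: "L (t, x) v = (1 - t) * x v + t * y v" for v by (simp add: L_def y_def)
      have "x v \<noteq> 0" if "L (t, x) v \<noteq> 0" for v
      proof
        assume xv: "x v = 0"
        then have "y v \<noteq> 0" using that Lv[of v] by auto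
        then have "0 < a x v" using b_nz unfolding y_def by blast
        then show False using xv c0 by (simp add: a_def)
      qed
      moreover have "0 \<le> L (t, x) v" for v
        unfolding Lv using t x y by (simp add: clique_points_def)
      moreover have "(\<Sum>v\<in>V. L (t, x) v) = 1"
        using x y by (simp add: Lv sum.distrib clique_points_def flip: sum_distrib_left)
      ultimately show "L (t, x) \<in> clique_points"
        using x y by (auto simp: clique_points_def Lv)
    qed
  qed (auto simp: L_def)
qed

end

lemma geometric_realization_vietoris_rips:
  assumes "reflexive_graph V (\<lambda>u v. d u v \<le> r)"
  shows "geometric_realization (vietoris_rips d V r) =
         top_of_set (reflexive_graph.clique_points V (\<lambda>u v. d u v \<le> r))"
proof -
  interpret reflexive_graph V "\<lambda>u v. d u v \<le> r" by fact
  have "(\<forall>v. 0 \<le> x v) \<and> {v. x v \<noteq> 0} \<in> vietoris_rips d V r \<and> (\<Sum>v\<in>{v. x v \<noteq> 0}. x v) = 1 \<longleftrightarrow>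
      x \<in> clique_points" for x :: "'a \<Rightarrow> real"
  proof (cases "\<forall>v. v \<notin> V \<longrightarrow> x v = 0")
    case True
    then have sub: "{v. x v \<noteq> 0} \<subseteq> V" by auto
    have sum: "(\<Sum>v\<in>{v. x v \<noteq> 0}. x v) = (\<Sum>v\<in>V. x v)"
      by (rule sum.mono_neutral_left[OF finite_V sub]) auto
    have clique: "(\<forall>a\<in>{v. x v \<noteq> 0}. \<forall>b\<in>{v. x v \<noteq> 0}. d a b \<le> r) \<longleftrightarrow>
        (\<forall>u\<in>V. \<forall>v\<in>V. x u \<noteq> 0 \<and> x v \<noteq> 0 \<longrightarrow> d u v \<le> r)"
      using sub by blast
    have "{v. x v \<noteq> 0} \<noteq> {}" if "(\<Sum>v\<in>V. x v) = 1"
      using that by (metis (mono_tags, lifting) empty_Collect_eq sum.neutral zero_neq_one)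
    then show ?thesis
      using True sub finite_subset[OF sub finite_V]
      unfolding sum vietoris_rips_def clique_points_def mem_Collect_eq[of "{v. x v \<noteq> 0}"] clique
      by blast
  next
    case False
    then show ?thesis by (auto simp: vietoris_rips_def clique_points_def)
  qed
  then show ?thesis
    by (simp add: geometric_realization_def euclidean_product_topology)
qed

section \<open>Counting in the hypercube\<close>

lemma card_hypercube: "finite (hypercube n) \<and> card (hypercube n) = 2 ^ n"
  using card_lists_length_eq[of "UNIV :: bool set" n] finite_lists_length_eq[of "UNIV :: bool set" n]
  by (simp add: hypercube_def)

text \<open>A string corresponds to the set of positions where it differs from \<open>t\<close>; the
  inverse flips \<open>t\<close> at those positions.\<close>

lemma card_hypercube_far:
  assumes t: "t \<in> hypercube n"
  shows "card {w \<in> hypercube n. r < hamming t w} = (\<Sum>i = r + 1..n. n choose i)"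
proof -
  define D where "D w = {i. i < length t \<and> t ! i \<noteq> w ! i}" for w
  have len: "length t = n" using t by (simp add: hypercube_def)
  have "bij_betw D {w \<in> hypercube n. r < hamming t w} {S. S \<subseteq> {..<n} \<and> r < card S}"
  proof (rule bij_betw_byWitness[where f' = "\<lambda>S. map (\<lambda>i. (i \<in> S) \<noteq> t ! i) [0..<n]"])
    show "\<forall>w\<in>{w \<in> hypercube n. r < hamming t w}. map (\<lambda>i. (i \<in> D w) \<noteq> t ! i) [0..<n] = w"
      by (auto simp: hypercube_def D_def len intro!: nth_equalityI)
    show inv: "\<forall>S\<in>{S. S \<subseteq> {..<n} \<and> r < card S}. D (map (\<lambda>i. (i \<in> S) \<noteq> t ! i) [0..<n]) = S"
      by (auto simp: D_def len)
    show "D ` {w \<in> hypercube n. r < hamming t w} \<subseteq> {S. S \<subseteq> {..<n} \<and> r < card S}"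
      by (auto simp: D_def hamming_def len)
    show "(\<lambda>S. map (\<lambda>i. (i \<in> S) \<noteq> t ! i) [0..<n]) ` {S. S \<subseteq> {..<n} \<and> r < card S}
        \<subseteq> {w \<in> hypercube n. r < hamming t w}"
      using inv by (auto simp: hypercube_def hamming_def D_def)
  qed
  then have "card {w \<in> hypercube n. r < hamming t w} = card {S. S \<subseteq> {..<n} \<and> r < card S}"
    by (rule bij_betw_same_card)
  also have "{S. S \<subseteq> {..<n} \<and> r < card S} = (\<Union>i\<in>{r + 1..n}. {S. S \<subseteq> {..<n} \<and> card S = i})"
    using card_mono[of "{..<n}"] by (auto simp: Suc_le_eq)
  also have "card \<dots> = (\<Sum>i\<in>{r + 1..n}. card {S. S \<subseteq> {..<n} \<and> card S = i})"
    by (rule card_UN_disjoint) auto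
  also have "\<dots> = (\<Sum>i = r + 1..n. n choose i)"
    using n_subsets[of "{..<n}"] by simp
  finally show ?thesis .
qed

lemma reflexive_graph_hypercube: "reflexive_graph (hypercube n) (\<lambda>u v. hamming u v \<le> r)"
proof
  show "finite (hypercube n)" using card_hypercube by blast
  show "hamming v v \<le> r" for v :: "bool list" by (simp add: hamming_def)
  show "hamming v u \<le> r" if "u \<in> hypercube n" "v \<in> hypercube n" "hamming u v \<le> r" for u v
  proof -
    have "hamming v u = hamming u v"
      using that unfolding hamming_def hypercube_def by (intro arg_cong[where f = card]) auto
    then show ?thesis using that by simp
  qed
qed

text \<open>Union bound: a string that is no common neighbour of \<open>T\<close> is far from some
  member of \<open>T\<close>, and each member excludes the same number of strings.\<close>

lemma dominating_hypercube:
  assumes "k * (\<Sum>i = r + 1..n. n choose i) < 2 ^ n"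
  shows "reflexive_graph.dominating (hypercube n) (\<lambda>u v. hamming u v \<le> r) k (hypercube n)"
proof -
  interpret reflexive_graph "hypercube n" "\<lambda>u v. hamming u v \<le> r"
    by (rule reflexive_graph_hypercube)
  have "\<exists>w\<in>hypercube n. \<forall>t\<in>T. hamming t w \<le> r" if T: "T \<subseteq> hypercube n" "card T \<le> k" for T
  proof (rule ccontr)
    assume "\<not> ?thesis"
    then have "hypercube n \<subseteq> (\<Union>t\<in>T. {w \<in> hypercube n. r < hamming t w})"
      unfolding not_le[symmetric] by blast
    moreover have finT: "finite T" using T finite_V finite_subset by blast
    ultimately have "card (hypercube n) \<le> card (\<Union>t\<in>T. {w \<in> hypercube n. r < hamming t w})"
      using finite_V by (intro card_mono) auto
    also have "\<dots> \<le> (\<Sum>t\<in>T. card {w \<in> hypercube n. r < hamming t w})"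
      by (rule card_UN_le[OF finT])
    also have "\<dots> = card T * (\<Sum>i = r + 1..n. n choose i)"
      using T card_hypercube_far[of _ n r] by (simp add: subset_iff)
    also have "\<dots> \<le> k * (\<Sum>i = r + 1..n. n choose i)" using T by simp
    finally show False using assms card_hypercube[of n] by simp
  qed
  then show ?thesis by (simp add: dominating_def)
qed

theorem theorem2p3:
  fixes n r :: nat and \<alpha> :: real and k :: int
  assumes "1 \<le> n" and "r \<le> n - 1"
    and "\<alpha> = 2 ^ (n - 1) / (\<Sum>i = r + 1..n. real (n choose i))"
    and "\<alpha> \<notin> \<int> \<Longrightarrow> k = \<lfloor>\<alpha>\<rfloor>"
    and "\<alpha> \<in> \<int> \<Longrightarrow> real_of_int k = \<alpha> - 1"
  shows "n_connected_space (k - 1) (geometric_realization (vietoris_rips hamming (hypercube n) r))"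
proof -
  interpret reflexive_graph "hypercube n" "\<lambda>u v. hamming u v \<le> r"
    by (rule reflexive_graph_hypercube)
  define m where "m = (\<Sum>i = r + 1..n. n choose i)"
  \<comment> \<open>The term \<open>i = n\<close> makes the denominator of \<alpha> positive; it is
    in the range because \<open>r < n\<close>.\<close>
  have "n choose n \<le> m"
    unfolding m_def using assms(1,2) by (intro member_le_sum) auto
  then have m: "0 < real m" by simp
  have \<alpha>: "\<alpha> = 2 ^ (n - 1) / real m" using assms(3) by (simp add: m_def)
  then have \<alpha>0: "0 < \<alpha>" using m by simp
  \<comment> \<open>In both cases \<open>k\<close> is the greatest integer strictly below \<alpha>,
    and the union bound needs exactly this strictness.\<close>
  have k\<alpha>: "real_of_int k < \<alpha>" and k0: "0 \<le> k"
  proof -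
    show "real_of_int k < \<alpha>"
    proof (cases "\<alpha> \<in> \<int>")
      case False
      then have "k = \<lfloor>\<alpha>\<rfloor>" "real_of_int \<lfloor>\<alpha>\<rfloor> \<noteq> \<alpha>" using assms(4) by (auto simp: Ints_def)
      then show ?thesis by (metis of_int_floor_le order_le_less)
    qed (use assms(5) in simp)
    show "0 \<le> k"
    proof (cases "\<alpha> \<in> \<int>")
      case True
      then have "-1 < real_of_int k" using assms(5) \<alpha>0 by simp
      then show ?thesis by linarith
    qed (use assms(4) \<alpha>0 in simp)
  qed
  have "real_of_int k * real m < 2 ^ (n - 1)" using k\<alpha> m \<alpha> by (simp add: pos_less_divide_eq)
  then have "2 * (real_of_int k * real m) < 2 * 2 ^ (n - 1)" by simp
  also have "(2::real) * 2 ^ (n - 1) = 2 ^ n" using assms(1) by (simp flip: power_Suc)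
  finally have "real (2 * nat k * m) < real (2 ^ n)" using k0 by simp
  then have "2 * nat k * m < 2 ^ n" by (simp only: of_nat_less_iff)
  then have "dominating (2 * nat k) (hypercube n)" unfolding m_def by (rule dominating_hypercube)
  then have "cell_connected (Suc (nat k)) (thick (hypercube n))"
    using cell_connected_dominating by blast
  moreover have "hypercube n \<noteq> {}" using card_hypercube[of n] by auto
  ultimately have conn: "cell_connected (Suc (nat k)) clique_points"
    using cell_connected_clique_points by blast
  \<comment> \<open>From \<open>i \<le> k - 1\<close> follows \<open>i + 2 \<le> k + 1\<close>, the
    degree available in \<open>conn\<close>; for \<open>k = 0\<close> there is no such
    \<open>i\<close>.\<close>
  have "is_singleton (homotopy_group_set i (top_of_set clique_points) x)"
    if "int i \<le> k - 1" "x \<in> clique_points" for i x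
    using that cell_connected_mono[OF conn, of "i + 2"] by (intro homotopy_group_set_trivial) auto
  then show ?thesis
    using cell_connected_nonempty[OF conn]
    by (simp add: n_connected_space_def geometric_realization_vietoris_rips[OF reflexive_graph_hypercube])
qed

end
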